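(* Every Moufang quadrangle in characteristic different from $2$ arises from a special Jordan module by Construction (M) of the context. Precisely: let $(U_+;U_1,U_2,U_3,U_4)$ be a root group sequence of one of the types (a) quadratic form type, (b) involutory type, (c) pseudo-quadratic form type, (d) type $E_6$, $E_7$ or $E_8$, listed in the context, all over (skew) fields of characteristic different from $2$. Then there exist a field of characteristic different from $2$, a non-degenerate Jordan algebra $J$ over it with supplementary proper idempotents $e_0,e_1$ such that every nonzero element of $J_{1/2}$ is invertible, an element $u\in J_{1/2}$ with $u^2=1$, and a special $J$-module $X$ (possibly zero) with a bilinear skew-symmetric form $\beta:X\times X\to J$, such that the root groups and commutator relations produced by Construction (M) from $(J,e_0,e_1,u,X,\beta)$ coincide, up to isomorphism, with those of $(U_+;U_1,U_2,U_3,U_4)$. Moreover one can take: in case (a), $J$ the reduced spin factor of the given quadratic space and $X=0$; in case (b), $J=\mathcal H(M_2(L),\sigma t)$ and $X=0$; in case (c), $J=\mathcal H(M_2(L),\sigma t)$ and $X=Y^2$ (row vectors over the given right $L$-vector space $Y$), with action $j\bullet x=xj$; in case (d), $J$ a reduced spin factor of the given quadratic space.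
   Context: **Jordan notions.** A Jordan $k$-algebra ($\operatorname{char}k\neq2$) is a unital commutative $k$-algebra with $(x^2y)x=x^2(yx)$; $U_xy:=2x(xy)-x^2y$; it is non-degenerate if $U_x=0$ implies $x=0$. $x$ is invertible if $xy=1$, $x^2y=x$ for some $y$. Supplementary proper idempotents: $e_i^2=e_i\notin\{0,1\}$, $e_0+e_1=1$. Peirce subspaces: $J_i=\{x\mid e_1x=ix\}$, $i\in\{0,\frac12,1\}$. A special $J$-module is a $k$-vector space $X$ with bilinear action $\bullet:J\times X\to X$ such that $1\bullet x=x$ and $(U_jj')\bullet x=j\bullet(j'\bullet(j\bullet x))$; put $X_0=\{x\mid e_0\bullet x=x\}$. Reduced spin factor of $(k,V,q)$, with $f$ the bilinear form of $q$: $ke_0\oplus V\oplus ke_1$ with $(t_1e_i)(t_2e_j)=\delta_{ij}t_1t_2e_i$, $(te_i)v=\frac12tv$, $vw=\frac12f(v,w)(e_0+e_1)$. For a skew field $L$ with involution $\sigma$, $L_\sigma=\{\ell\mid\ell^\sigma=\ell\}$, $\mathcal H(M_2(L),\sigma t)$ is the set of $2\times2$ matrices $m$ over $L$ with $m^{\sigma t}=m$ ($t$ = transpose), with product $\frac12(mn+nm)$, $e_0=\operatorname{diag}(1,0)$, $e_1=\operatorname{diag}(0,1)$. **Construction (M).** Let $(J,e_0,e_1,u,X,\beta)$ be as in the claim. Let $V:=(J_{1/2},+)$ and let $W:=X_0\times J_0$ be the group with operation $[a_1,t_1]\boxplus[a_2,t_2]=[a_1+a_2,t_1+t_2+\frac12\beta(a_2,a_1)]$.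 Let $U_1,U_3$ be groups isomorphic to $W$ via $x_1,x_3$, and $U_2,U_4$ groups isomorphic to $V$ via $x_2,x_4$. $U_+=\langle U_1,U_2,U_3,U_4\rangle$ is defined by $$[x_1(a_1,t_1),x_3(a_2,t_2)^{-1}]=x_2(\beta(u\bullet a_1,a_2)),\quad [x_2(v_1),x_4(v_2)^{-1}]=x_3(0,2(v_1v_2)e_0),$$ $$[x_1(a,t),x_4(v)^{-1}]=x_2\bigl(\tfrac12\beta(u\bullet a,v\bullet(u\bullet a))+2(U_ut)v\bigr)\,x_3\bigl(v\bullet(u\bullet a),U_vU_ut\bigr),$$ and $[U_i,U_{i+1}]=1$ for $i=1,2,3$. **Root group sequences.** A Moufang quadrangle (a thick generalized quadrangle all of whose roots are Moufang) is determined by its root groups $U_1,\dots,U_4$ and their commutator relations (which define $U_+=\langle U_1,\dots,U_4\rangle$). By the Tits–Weiss classification, the Moufang quadrangles that occur in characteristic different from $2$ (i.e. the four types below, the remaining indifferent and $F_4$ types existing only in characteristic $2$) are those with the following root group sequences ($[U_i,U_{i+1}]=1$ for $i=1,2,3$ always; the commutator convention is the same throughout). (a) Quadratic form type: $(k,V,q)$ an anisotropic non-degenerate quadratic space with base point, bilinear form $f$; $U_1,U_3\cong(k,+)$, $U_2,U_4\cong(V,+)$; $[x_1(t_1),x_3(t_2)^{-1}]=1$, $[x_2(v_1),x_4(v_2)^{-1}]=x_3(f(v_1,v_2))$, $[x_1(t),x_4(v)^{-1}]=x_2(tv)x_3(q(v)t)$. (b) Involutory type: $L$ a field or skew field with involution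 $\sigma$; $U_1,U_3\cong(L_\sigma,+)$, $U_2,U_4\cong(L,+)$; $[x_1(\alpha_1),x_3(\alpha_2)^{-1}]=1$, $[x_2(\ell_1),x_4(\ell_2)^{-1}]=x_3(\ell_1^\sigma\ell_2+\ell_2^\sigma\ell_1)$, $[x_1(\alpha),x_4(\ell)^{-1}]=x_2(\alpha\ell)x_3(\ell^\sigma\alpha\ell)$. (c) Pseudo-quadratic form type: $L$ a skew field with involution $\sigma$, $Y$ a right $L$-vector space, $h:Y\times Y\to L$ skew-hermitian (bi-additive, $h(x,yu)=h(x,y)u$, $h(x,y)^\sigma=-h(y,x)$), $\pi(a)=\frac12h(a,a)$ anisotropic ($\pi(a)\in L_\sigma$ only if $a=0$); $U_1,U_3\cong Y\times L_\sigma$ with operation $[a_1,\alpha_1]\boxplus[a_2,\alpha_2]=[a_1+a_2,\alpha_1+\alpha_2+\frac12(h(a_2,a_1)-h(a_1,a_2))]$, $U_2,U_4\cong(L,+)$; $[x_1(a_1,\alpha_1),x_3(a_2,\alpha_2)^{-1}]=x_2(h(a_1,a_2))$, $[x_2(\ell_1),x_4(\ell_2)^{-1}]=x_3(0,\ell_1^\sigma\ell_2+\ell_2^\sigma\ell_1)$, $[x_1(a,\alpha),x_4(\ell)^{-1}]=x_2(\frac12h(a,a\ell)+\alpha\ell)\,x_3(a\ell,\ell^\sigma\alpha\ell)$. (d) Type $E_6,E_7,E_8$: $(k,L,q,1,Z,\cdot,h)$ a quadrangular algebra with $(k,L,q)$ a quadratic space of type $E_6,E_7,E_8$ and $\dim_kZ=8,16,32$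 respectively; $f$ the bilinear form of $q$, $\theta(a,v)=\frac12h(a,a\cdot v)$, $g(a,b)=\frac12f(h(b,a),1)$; $U_1,U_3\cong Z\times k$ with operation $[a_1,t_1]\boxplus[a_2,t_2]=[a_1+a_2,t_1+t_2+g(a_1,a_2)]$, $U_2,U_4\cong(L,+)$; $[x_1(a_1,t_1),x_3(a_2,t_2)^{-1}]=x_2(h(a_1,a_2))$, $[x_2(v_1),x_4(v_2)^{-1}]=x_3(0,f(v_1,v_2))$, $[x_1(a,t),x_4(v)^{-1}]=x_2(\theta(a,v)+tv)\,x_3(a\cdot v,q(v)t)$. **Quadrangular algebra** ($\operatorname{char}k\ne2$): 7-tuple $(k,L,q,1,Z,\cdot,h)$, $q$ anisotropic quadratic form on the $k$-vector space $L$, $q(1)=1$, $Z\neq0$ a $k$-vector space, maps $\cdot:Z\times L\to Z$, $h:Z\times Z\to L$, such that, with $v^\sigma=f(1,v)1-v$, $v^{-1}=v^\sigma/q(v)$: $\cdot$ and $h$ are $k$-bilinear; $x\cdot1=x$; $(xv)v^{-1}=x$ for $v\ne0$; $h(x,yv)=h(y,xv)+f(h(x,y),1)v$; $f(h(xv,y),1)=f(h(x,y),v)$; with $\pi(x)=\theta(x,1)$, $x\theta(x,v)=(x\pi(x))v$; $\pi(x)\neq0$ for $x\ne0$. **Quadratic spaces of type $E_6,E_7,E_8$**: anisotropic with base point, and for some separable quadratic field extension $E/k$ with norm $N$ and $s_i\in k^*$: $q\cong N\otimes\langle1,s_2,s_3\rangle$; resp. $q\cong N\otimes\langle1,s_2,s_3,s_4\rangle$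 with $s_2s_3s_4\notin N(E)$; resp. $q\cong N\otimes\langle1,s_2,\dots,s_6\rangle$ with $-s_2s_3s_4s_5s_6\in N(E)$. *)

theory Defs
  imports
    "HOL-Algebra.Algebraic_Closure_Type"
    "HOL-Analysis.Finite_Cartesian_Product"
begin

section \<open>Jordan algebras and special modules\<close>

text \<open>
  A non-associative algebra over \<open>K\<close> is stored in the record type of modules: \<open>mult\<close> and
  \<open>one\<close> carry the Jordan product and the unit, \<open>smult\<close> the scalar action.
\<close>

definition jordan_U :: "('k, 'j) module \<Rightarrow> 'j \<Rightarrow> 'j \<Rightarrow> 'j" where
  "jordan_U J x y =
     (x \<otimes>\<^bsub>J\<^esub> (x \<otimes>\<^bsub>J\<^esub> y) \<oplus>\<^bsub>J\<^esub> x \<otimes>\<^bsub>J\<^esub> (x \<otimes>\<^bsub>J\<^esub> y)) \<ominus>\<^bsub>J\<^esub> (x \<otimes>\<^bsub>J\<^esub> x) \<otimes>\<^bsub>J\<^esub> y"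

definition half :: "'k ring \<Rightarrow> 'k" where
  "half K = inv\<^bsub>K\<^esub> (\<one>\<^bsub>K\<^esub> \<oplus>\<^bsub>K\<^esub> \<one>\<^bsub>K\<^esub>)"

definition field_char_not_2 :: "'k ring \<Rightarrow> bool" where
  "field_char_not_2 K \<longleftrightarrow> field K \<and> \<one>\<^bsub>K\<^esub> \<oplus>\<^bsub>K\<^esub> \<one>\<^bsub>K\<^esub> \<noteq> \<zero>\<^bsub>K\<^esub>"

definition linear_on :: "'k ring \<Rightarrow> ('k, 'a) module \<Rightarrow> ('k, 'b) module \<Rightarrow> ('a \<Rightarrow> 'b) \<Rightarrow> bool" where
  "linear_on K A B f \<longleftrightarrow>
     f \<in> carrier A \<rightarrow> carrier B \<and>
     (\<forall>x\<in>carrier A. \<forall>y\<in>carrier A. f (x \<oplus>\<^bsub>A\<^esub> y) = f x \<oplus>\<^bsub>B\<^esub> f y) \<and>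
     (\<forall>c\<in>carrier K. \<forall>x\<in>carrier A. f (c \<odot>\<^bsub>A\<^esub> x) = c \<odot>\<^bsub>B\<^esub> f x)"

definition bilinear_on ::
  "'k ring \<Rightarrow> ('k, 'a) module \<Rightarrow> ('k, 'b) module \<Rightarrow> ('k, 'c) module \<Rightarrow> ('a \<Rightarrow> 'b \<Rightarrow> 'c) \<Rightarrow> bool" where
  "bilinear_on K A B C f \<longleftrightarrow>
     (\<forall>x\<in>carrier A. linear_on K B C (f x)) \<and>
     (\<forall>y\<in>carrier B. linear_on K A C (\<lambda>x. f x y))"

definition jordan_algebra :: "'k ring \<Rightarrow> ('k, 'j) module \<Rightarrow> bool" where
  "jordan_algebra K J \<longleftrightarrow>
     field_char_not_2 K \<and> Module.module K J \<and> bilinear_on K J J J (monoid.mult J) \<and>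
     \<one>\<^bsub>J\<^esub> \<in> carrier J \<and>
     (\<forall>x\<in>carrier J. \<one>\<^bsub>J\<^esub> \<otimes>\<^bsub>J\<^esub> x = x) \<and>
     (\<forall>x\<in>carrier J. \<forall>y\<in>carrier J. x \<otimes>\<^bsub>J\<^esub> y = y \<otimes>\<^bsub>J\<^esub> x) \<and>
     (\<forall>x\<in>carrier J. \<forall>y\<in>carrier J.
        ((x \<otimes>\<^bsub>J\<^esub> x) \<otimes>\<^bsub>J\<^esub> y) \<otimes>\<^bsub>J\<^esub> x = (x \<otimes>\<^bsub>J\<^esub> x) \<otimes>\<^bsub>J\<^esub> (y \<otimes>\<^bsub>J\<^esub> x))"

definition jordan_nondegenerate :: "('k, 'j) module \<Rightarrow> bool" where
  "jordan_nondegenerate J \<longleftrightarrow>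
     (\<forall>x\<in>carrier J. (\<forall>y\<in>carrier J. jordan_U J x y = \<zero>\<^bsub>J\<^esub>) \<longrightarrow> x = \<zero>\<^bsub>J\<^esub>)"

definition jordan_invertible :: "('k, 'j) module \<Rightarrow> 'j \<Rightarrow> bool" where
  "jordan_invertible J x \<longleftrightarrow>
     (\<exists>y\<in>carrier J. x \<otimes>\<^bsub>J\<^esub> y = \<one>\<^bsub>J\<^esub> \<and> (x \<otimes>\<^bsub>J\<^esub> x) \<otimes>\<^bsub>J\<^esub> y = x)"

definition supplementary_proper_idempotents :: "('k, 'j) module \<Rightarrow> 'j \<Rightarrow> 'j \<Rightarrow> bool" where
  "supplementary_proper_idempotents J e0 e1 \<longleftrightarrow>
     e0 \<in> carrier J \<and> e1 \<in> carrier J \<and>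
     e0 \<otimes>\<^bsub>J\<^esub> e0 = e0 \<and> e1 \<otimes>\<^bsub>J\<^esub> e1 = e1 \<and>
     e0 \<notin> {\<zero>\<^bsub>J\<^esub>, \<one>\<^bsub>J\<^esub>} \<and> e1 \<notin> {\<zero>\<^bsub>J\<^esub>, \<one>\<^bsub>J\<^esub>} \<and>
     e0 \<oplus>\<^bsub>J\<^esub> e1 = \<one>\<^bsub>J\<^esub>"

text \<open>\<open>peirce J e1 c\<close> is the Peirce subspace \<open>J\<^sub>c\<close>, for \<open>c\<close> one of \<open>0\<close>, \<open>1/2\<close>, \<open>1\<close> in \<open>K\<close>.\<close>

definition peirce :: "('k, 'j) module \<Rightarrow> 'j \<Rightarrow> 'k \<Rightarrow> 'j set" where
  "peirce J e1 c = {x \<in> carrier J. e1 \<otimes>\<^bsub>J\<^esub> x = c \<odot>\<^bsub>J\<^esub> x}"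

definition special_module ::
  "'k ring \<Rightarrow> ('k, 'j) module \<Rightarrow> ('k, 'x) module \<Rightarrow> ('j \<Rightarrow> 'x \<Rightarrow> 'x) \<Rightarrow> bool" where
  "special_module K J M act \<longleftrightarrow>
     Module.module K M \<and> bilinear_on K J M M act \<and>
     (\<forall>x\<in>carrier M. act \<one>\<^bsub>J\<^esub> x = x) \<and>
     (\<forall>j\<in>carrier J. \<forall>j'\<in>carrier J. \<forall>x\<in>carrier M.
        act (jordan_U J j j') x = act j (act j' (act j x)))"

definition special_module_0 :: "('k, 'x) module \<Rightarrow> ('j \<Rightarrow> 'x \<Rightarrow> 'x) \<Rightarrow> 'j \<Rightarrow> 'x set" where
  "special_module_0 M act e0 = {x \<in> carrier M. act e0 x = x}"

definition M_input ::
  "'k ring \<Rightarrow> ('k, 'j) module \<Rightarrow> 'j \<Rightarrow> 'j \<Rightarrow> 'j \<Rightarrow>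
   ('k, 'x) module \<Rightarrow> ('j \<Rightarrow> 'x \<Rightarrow> 'x) \<Rightarrow> ('x \<Rightarrow> 'x \<Rightarrow> 'j) \<Rightarrow> bool" where
  "M_input K J e0 e1 u M act \<beta> \<longleftrightarrow>
     jordan_algebra K J \<and> jordan_nondegenerate J \<and>
     supplementary_proper_idempotents J e0 e1 \<and>
     (\<forall>v\<in>peirce J e1 (half K). v \<noteq> \<zero>\<^bsub>J\<^esub> \<longrightarrow> jordan_invertible J v) \<and>
     u \<in> peirce J e1 (half K) \<and> u \<otimes>\<^bsub>J\<^esub> u = \<one>\<^bsub>J\<^esub> \<and>
     special_module K J M act \<and>
     bilinear_on K M M J \<beta> \<and>
     (\<forall>x\<in>carrier M. \<forall>y\<in>carrier M. \<beta> x y = \<ominus>\<^bsub>J\<^esub> \<beta> y x)"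


section \<open>Root groups and commutator relations\<close>

text \<open>
  In every case below \<open>U\<^sub>1, U\<^sub>3\<close> are parametrized by one group and \<open>U\<^sub>2, U\<^sub>4\<close> by another.
  The four maps are the right-hand sides of the relations
  \<open>[x\<^sub>1(a), x\<^sub>3(b)\<^sup>-\<^sup>1] = x\<^sub>2(c13 a b)\<close>, \<open>[x\<^sub>2(v), x\<^sub>4(w)\<^sup>-\<^sup>1] = x\<^sub>3(c24 v w)\<close> and
  \<open>[x\<^sub>1(a), x\<^sub>4(v)\<^sup>-\<^sup>1] = x\<^sub>2(c14_2 a v) x\<^sub>3(c14_3 a v)\<close>.
\<close>

record ('a, 'b) root_data =
  grp13 :: "'a monoid"
  grp24 :: "'b monoid"
  c13 :: "'a \<Rightarrow> 'a \<Rightarrow> 'b"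
  c24 :: "'b \<Rightarrow> 'b \<Rightarrow> 'a"
  c14_2 :: "'a \<Rightarrow> 'b \<Rightarrow> 'b"
  c14_3 :: "'a \<Rightarrow> 'b \<Rightarrow> 'a"

definition root_data_wf :: "('a, 'b) root_data \<Rightarrow> bool" where
  "root_data_wf D \<longleftrightarrow>
     group (grp13 D) \<and> group (grp24 D) \<and>
     (\<forall>a\<in>carrier (grp13 D). \<forall>b\<in>carrier (grp13 D). c13 D a b \<in> carrier (grp24 D)) \<and>
     (\<forall>v\<in>carrier (grp24 D). \<forall>w\<in>carrier (grp24 D). c24 D v w \<in> carrier (grp13 D)) \<and>
     (\<forall>a\<in>carrier (grp13 D). \<forall>v\<in>carrier (grp24 D).
        c14_2 D a v \<in> carrier (grp24 D) \<and> c14_3 D a v \<in> carrier (grp13 D))"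

definition root_data_iso :: "('a, 'b) root_data \<Rightarrow> ('c, 'd) root_data \<Rightarrow> bool" where
  "root_data_iso D D' \<longleftrightarrow>
     root_data_wf D \<and> root_data_wf D' \<and>
     (\<exists>\<phi>1\<in>iso (grp13 D) (grp13 D'). \<exists>\<phi>2\<in>iso (grp24 D) (grp24 D').
      \<exists>\<phi>3\<in>iso (grp13 D) (grp13 D'). \<exists>\<phi>4\<in>iso (grp24 D) (grp24 D').
        (\<forall>a\<in>carrier (grp13 D). \<forall>b\<in>carrier (grp13 D).
           \<phi>2 (c13 D a b) = c13 D' (\<phi>1 a) (\<phi>3 b)) \<and>
        (\<forall>v\<in>carrier (grp24 D). \<forall>w\<in>carrier (grp24 D).
           \<phi>3 (c24 D v w) = c24 D' (\<phi>2 v) (\<phi>4 w)) \<and>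
        (\<forall>a\<in>carrier (grp13 D). \<forall>v\<in>carrier (grp24 D).
           \<phi>2 (c14_2 D a v) = c14_2 D' (\<phi>1 a) (\<phi>4 v) \<and>
           \<phi>3 (c14_3 D a v) = c14_3 D' (\<phi>1 a) (\<phi>4 v)))"

text \<open>
  The Tits--Weiss convention \<open>[a,b] = a\<^sup>-\<^sup>1 b\<^sup>-\<^sup>1 a b\<close>, for which the relations of the listed
  quadrangles are consistent (with \<open>a b a\<^sup>-\<^sup>1 b\<^sup>-\<^sup>1\<close> those of quadratic form type are not).
\<close>

definition commutator :: "('g, 'm) monoid_scheme \<Rightarrow> 'g \<Rightarrow> 'g \<Rightarrow> 'g" where
  "commutator G a b = inv\<^bsub>G\<^esub> a \<otimes>\<^bsub>G\<^esub> inv\<^bsub>G\<^esub> b \<otimes>\<^bsub>G\<^esub> a \<otimes>\<^bsub>G\<^esub> b"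

text \<open>
  \<open>(U; U1, U2, U3, U4)\<close> is the group with root groups defined by the relations in \<open>D\<close>. That the
  relations \<^emph>\<open>define\<close> \<open>U\<close> is expressed by the unique factorization \<open>U = U1 U2 U3 U4\<close> valid in
  every root group sequence: together with the relations it determines the multiplication of \<open>U\<close>,
  and it implies that \<open>U\<close> is generated by the root groups.
\<close>

definition root_group_sequence ::
  "'g monoid \<Rightarrow> 'g set \<Rightarrow> 'g set \<Rightarrow> 'g set \<Rightarrow> 'g set \<Rightarrow> ('a, 'b) root_data \<Rightarrow> bool" where
  "root_group_sequence U U1 U2 U3 U4 D \<longleftrightarrow>
     group U \<and> subgroup U1 U \<and> subgroup U2 U \<and> subgroup U3 U \<and> subgroup U4 U \<and>
     bij_betw (\<lambda>(a, b, c, d). a \<otimes>\<^bsub>U\<^esub> b \<otimes>\<^bsub>U\<^esub> c \<otimes>\<^bsub>U\<^esub> d) (U1 \<times> U2 \<times> U3 \<times> U4) (carrier U) \<and>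
     (\<forall>a\<in>U1. \<forall>b\<in>U2. commutator U a b = \<one>\<^bsub>U\<^esub>) \<and>
     (\<forall>b\<in>U2. \<forall>c\<in>U3. commutator U b c = \<one>\<^bsub>U\<^esub>) \<and>
     (\<forall>c\<in>U3. \<forall>d\<in>U4. commutator U c d = \<one>\<^bsub>U\<^esub>) \<and>
     (\<exists>x1\<in>iso (grp13 D) (U\<lparr>carrier := U1\<rparr>). \<exists>x2\<in>iso (grp24 D) (U\<lparr>carrier := U2\<rparr>).
      \<exists>x3\<in>iso (grp13 D) (U\<lparr>carrier := U3\<rparr>). \<exists>x4\<in>iso (grp24 D) (U\<lparr>carrier := U4\<rparr>).
        (\<forall>a\<in>carrier (grp13 D). \<forall>b\<in>carrier (grp13 D).
           commutator U (x1 a) (inv\<^bsub>U\<^esub> x3 b) = x2 (c13 D a b)) \<and>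
        (\<forall>v\<in>carrier (grp24 D). \<forall>w\<in>carrier (grp24 D).
           commutator U (x2 v) (inv\<^bsub>U\<^esub> x4 w) = x3 (c24 D v w)) \<and>
        (\<forall>a\<in>carrier (grp13 D). \<forall>v\<in>carrier (grp24 D).
           commutator U (x1 a) (inv\<^bsub>U\<^esub> x4 v) = x2 (c14_2 D a v) \<otimes>\<^bsub>U\<^esub> x3 (c14_3 D a v)))"

definition additive_group :: "'a::ab_group_add set \<Rightarrow> 'a monoid" where
  "additive_group S = \<lparr>carrier = S, monoid.mult = (+), one = 0\<rparr>"

definition construction_M ::
  "'k ring \<Rightarrow> ('k, 'j) module \<Rightarrow> 'j \<Rightarrow> 'j \<Rightarrow> 'j \<Rightarrow>
   ('k, 'x) module \<Rightarrow> ('j \<Rightarrow> 'x \<Rightarrow> 'x) \<Rightarrow> ('x \<Rightarrow> 'x \<Rightarrow> 'j) \<Rightarrow> ('x \<times> 'j, 'j) root_data" where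
  "construction_M K J e0 e1 u M act \<beta> =
     \<lparr>grp13 =
        \<lparr>carrier = special_module_0 M act e0 \<times> peirce J e1 \<zero>\<^bsub>K\<^esub>,
         monoid.mult = (\<lambda>(a1, t1) (a2, t2).
           (a1 \<oplus>\<^bsub>M\<^esub> a2, t1 \<oplus>\<^bsub>J\<^esub> t2 \<oplus>\<^bsub>J\<^esub> half K \<odot>\<^bsub>J\<^esub> \<beta> a2 a1)),
         one = (\<zero>\<^bsub>M\<^esub>, \<zero>\<^bsub>J\<^esub>)\<rparr>,
      grp24 = \<lparr>carrier = peirce J e1 (half K), monoid.mult = add J, one = \<zero>\<^bsub>J\<^esub>\<rparr>,
      c13 = (\<lambda>(a1, t1) (a2, t2). \<beta> (act u a1) a2),
      c24 = (\<lambda>v1 v2.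
        (\<zero>\<^bsub>M\<^esub>, (v1 \<otimes>\<^bsub>J\<^esub> v2) \<otimes>\<^bsub>J\<^esub> e0 \<oplus>\<^bsub>J\<^esub> (v1 \<otimes>\<^bsub>J\<^esub> v2) \<otimes>\<^bsub>J\<^esub> e0)),
      c14_2 = (\<lambda>(a, t) v.
        half K \<odot>\<^bsub>J\<^esub> \<beta> (act u a) (act v (act u a)) \<oplus>\<^bsub>J\<^esub>
        (jordan_U J u t \<otimes>\<^bsub>J\<^esub> v \<oplus>\<^bsub>J\<^esub> jordan_U J u t \<otimes>\<^bsub>J\<^esub> v)),
      c14_3 = (\<lambda>(a, t) v. (act v (act u a), jordan_U J v (jordan_U J u t)))\<rparr>"

definition zero_module :: "('k, unit) module" where
  "zero_module = \<lparr>carrier = {()}, monoid.mult = (\<lambda>_ _. ()), one = (), zero = (), add = (\<lambda>_ _. ()),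
                  module.smult = (\<lambda>_ _. ())\<rparr>"


section \<open>Quadratic spaces and quadratic form type\<close>

definition polar :: "('v::ab_group_add \<Rightarrow> 'k::field) \<Rightarrow> 'v \<Rightarrow> 'v \<Rightarrow> 'k" where
  "polar q v w = q (v + w) - q v - q w"

definition quadratic_space ::
  "('k::field \<Rightarrow> 'v::ab_group_add \<Rightarrow> 'v) \<Rightarrow> ('v \<Rightarrow> 'k) \<Rightarrow> bool" where
  "quadratic_space s q \<longleftrightarrow>
     vector_space s \<and> (\<forall>c v. q (s c v) = c\<^sup>2 * q v) \<and>
     (\<forall>v. Vector_Spaces.linear s (*) (polar q v)) \<and>
     (\<forall>w. Vector_Spaces.linear s (*) (\<lambda>v. polar q v w))"

definition anisotropic :: "('v::ab_group_add \<Rightarrow> 'k::field) \<Rightarrow> bool" where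
  "anisotropic q \<longleftrightarrow> (\<forall>v. q v = 0 \<longrightarrow> v = 0)"

definition nondegenerate_form :: "('v::ab_group_add \<Rightarrow> 'k::field) \<Rightarrow> bool" where
  "nondegenerate_form q \<longleftrightarrow> (\<forall>v. (\<forall>w. polar q v w = 0) \<longrightarrow> v = 0)"

definition quadratic_form_type :: "('k::field \<Rightarrow> 'v::ab_group_add \<Rightarrow> 'v) \<Rightarrow> ('v \<Rightarrow> 'k) \<Rightarrow>
    ('k, 'v) root_data" where
  "quadratic_form_type s q =
     \<lparr>grp13 = additive_group UNIV, grp24 = additive_group UNIV,
      c13 = (\<lambda>t1 t2. 0), c24 = (\<lambda>v1 v2. polar q v1 v2),
      c14_2 = (\<lambda>t v. s t v), c14_3 = (\<lambda>t v. q v * t)\<rparr>"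

text \<open>The triple \<open>(t\<^sub>0, v, t\<^sub>1)\<close> stands for \<open>t\<^sub>0 e\<^sub>0 + v + t\<^sub>1 e\<^sub>1\<close>.\<close>

definition spin_factor ::
  "('k::field \<Rightarrow> 'v::ab_group_add \<Rightarrow> 'v) \<Rightarrow> ('v \<Rightarrow> 'k) \<Rightarrow> ('k, 'k \<times> 'v \<times> 'k) module" where
  "spin_factor s q =
     \<lparr>carrier = UNIV,
      monoid.mult = (\<lambda>(a0, v, a1) (b0, w, b1).
        (a0 * b0 + polar q v w / 2,
         s ((a0 + a1) / 2) w + s ((b0 + b1) / 2) v,
         a1 * b1 + polar q v w / 2)),
      one = (1, 0, 1), zero = (0, 0, 0),
      add = (\<lambda>(a0, v, a1) (b0, w, b1). (a0 + b0, v + w, a1 + b1)),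
      module.smult = (\<lambda>c (a0, v, a1). (c * a0, s c v, c * a1))\<rparr>"

definition spin_e0 :: "'k::field \<times> 'v::ab_group_add \<times> 'k" where
  "spin_e0 = (1, 0, 0)"

definition spin_e1 :: "'k::field \<times> 'v::ab_group_add \<times> 'k" where
  "spin_e1 = (0, 0, 1)"


section \<open>Skew fields with involution\<close>

text \<open>The identity of a commutative field counts as an involution.\<close>

definition involution :: "('l::division_ring \<Rightarrow> 'l) \<Rightarrow> bool" where
  "involution \<sigma> \<longleftrightarrow>
     (\<forall>a b. \<sigma> (a + b) = \<sigma> a + \<sigma> b) \<and> (\<forall>a b. \<sigma> (a * b) = \<sigma> b * \<sigma> a) \<and> (\<forall>a. \<sigma> (\<sigma> a) = a)"

definition fixed_elements :: "('l \<Rightarrow> 'l) \<Rightarrow> 'l set" where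
  "fixed_elements \<sigma> = {l. \<sigma> l = l}"

definition involutory_type :: "('l::division_ring \<Rightarrow> 'l) \<Rightarrow> ('l, 'l) root_data" where
  "involutory_type \<sigma> =
     \<lparr>grp13 = additive_group (fixed_elements \<sigma>), grp24 = additive_group UNIV,
      c13 = (\<lambda>\<alpha>1 \<alpha>2. 0), c24 = (\<lambda>l1 l2. \<sigma> l1 * l2 + \<sigma> l2 * l1),
      c14_2 = (\<lambda>\<alpha> l. \<alpha> * l), c14_3 = (\<lambda>\<alpha> l. \<sigma> l * \<alpha> * l)\<rparr>"

text \<open>
  The scalar multiplication is used only for scalars from a subfield \<open>K\<close> of \<open>L\<close> for which the
  result is a \<open>K\<close>-algebra, i.e. consisting of central elements fixed by \<open>\<sigma>\<close>.
\<close>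

definition hermitian_matrices ::
  "('l::division_ring \<Rightarrow> 'l) \<Rightarrow> ('l, 'l^2^2) module" where
  "hermitian_matrices \<sigma> =
     \<lparr>carrier = {m. transpose (map_matrix \<sigma> m) = m},
      monoid.mult = (\<lambda>m n. map_matrix (\<lambda>l. l / 2) (m ** n + n ** m)),
      one = mat 1, zero = 0, add = (+),
      module.smult = (\<lambda>c m. map_matrix (\<lambda>l. c * l) m)\<rparr>"

definition diag_e0 :: "'l::division_ring^2^2" where
  "diag_e0 = (\<chi> i j. if i = 1 \<and> j = 1 then 1 else 0)"

definition diag_e1 :: "'l::division_ring^2^2" where
  "diag_e1 = (\<chi> i j. if i = 2 \<and> j = 2 then 1 else 0)"

definition right_vector_space :: "('y::ab_group_add \<Rightarrow> 'l::division_ring \<Rightarrow> 'y) \<Rightarrow> bool" where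
  "right_vector_space r \<longleftrightarrow>
     (\<forall>x y a. r (x + y) a = r x a + r y a) \<and> (\<forall>x a b. r x (a + b) = r x a + r x b) \<and>
     (\<forall>x a b. r x (a * b) = r (r x a) b) \<and> (\<forall>x. r x 1 = x)"

definition skew_hermitian_form ::
  "('l::division_ring \<Rightarrow> 'l) \<Rightarrow> ('y::ab_group_add \<Rightarrow> 'l \<Rightarrow> 'y) \<Rightarrow> ('y \<Rightarrow> 'y \<Rightarrow> 'l) \<Rightarrow> bool" where
  "skew_hermitian_form \<sigma> r h \<longleftrightarrow>
     (\<forall>x y z. h (x + y) z = h x z + h y z) \<and> (\<forall>x y z. h x (y + z) = h x y + h x z) \<and>
     (\<forall>x y a. h x (r y a) = h x y * a) \<and> (\<forall>x y. \<sigma> (h x y) = - h y x)"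

definition pseudo_anisotropic ::
  "('l::division_ring \<Rightarrow> 'l) \<Rightarrow> ('y::ab_group_add \<Rightarrow> 'y \<Rightarrow> 'l) \<Rightarrow> bool" where
  "pseudo_anisotropic \<sigma> h \<longleftrightarrow> (\<forall>a. h a a / 2 \<in> fixed_elements \<sigma> \<longrightarrow> a = 0)"

definition pseudo_quadratic_form_type ::
  "('l::division_ring \<Rightarrow> 'l) \<Rightarrow> ('y::ab_group_add \<Rightarrow> 'l \<Rightarrow> 'y) \<Rightarrow> ('y \<Rightarrow> 'y \<Rightarrow> 'l) \<Rightarrow>
    ('y \<times> 'l, 'l) root_data" where
  "pseudo_quadratic_form_type \<sigma> r h =
     \<lparr>grp13 =
        \<lparr>carrier = UNIV \<times> fixed_elements \<sigma>,
         monoid.mult = (\<lambda>(a1, \<alpha>1) (a2, \<alpha>2). (a1 + a2, \<alpha>1 + \<alpha>2 + (h a2 a1 - h a1 a2) / 2)),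
         one = (0, 0)\<rparr>,
      grp24 = additive_group UNIV,
      c13 = (\<lambda>(a1, \<alpha>1) (a2, \<alpha>2). h a1 a2),
      c24 = (\<lambda>l1 l2. (0, \<sigma> l1 * l2 + \<sigma> l2 * l1)),
      c14_2 = (\<lambda>(a, \<alpha>) l. h a (r a l) / 2 + \<alpha> * l),
      c14_3 = (\<lambda>(a, \<alpha>) l. (r a l, \<sigma> l * \<alpha> * l))\<rparr>"

text \<open>Row vectors \<open>Y\<^sup>2\<close>, with central scalars acting on the right, and the action \<open>j \<bullet> x = x j\<close>.\<close>

definition row_module ::
  "('y::ab_group_add \<Rightarrow> 'l::division_ring \<Rightarrow> 'y) \<Rightarrow> ('l, 'y^2) module" where
  "row_module r =
     \<lparr>carrier = UNIV, monoid.mult = undefined, one = undefined, zero = 0, add = (+),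
      module.smult = (\<lambda>c x. \<chi> i. r (x $ i) c)\<rparr>"

definition row_action ::
  "('y::ab_group_add \<Rightarrow> 'l::division_ring \<Rightarrow> 'y) \<Rightarrow> 'l^2^2 \<Rightarrow> 'y^2 \<Rightarrow> 'y^2" where
  "row_action r m x = (\<chi> j. \<Sum>i\<in>UNIV. r (x $ i) (m $ i $ j))"


section \<open>Quadrangular algebras and types E6, E7, E8\<close>

definition qa_sigma ::
  "('k::field \<Rightarrow> 'v::ab_group_add \<Rightarrow> 'v) \<Rightarrow> ('v \<Rightarrow> 'k) \<Rightarrow> 'v \<Rightarrow> 'v \<Rightarrow> 'v" where
  "qa_sigma s q e v = s (polar q e v) e - v"

definition qa_inverse ::
  "('k::field \<Rightarrow> 'v::ab_group_add \<Rightarrow> 'v) \<Rightarrow> ('v \<Rightarrow> 'k) \<Rightarrow> 'v \<Rightarrow> 'v \<Rightarrow> 'v" where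
  "qa_inverse s q e v = s (1 / q v) (qa_sigma s q e v)"

definition qa_theta ::
  "('k::field \<Rightarrow> 'v::ab_group_add \<Rightarrow> 'v) \<Rightarrow> ('z \<Rightarrow> 'v \<Rightarrow> 'z) \<Rightarrow> ('z \<Rightarrow> 'z \<Rightarrow> 'v) \<Rightarrow>
    'z \<Rightarrow> 'v \<Rightarrow> 'v" where
  "qa_theta s m h a v = s (1 / 2) (h a (m a v))"

definition qa_g :: "('v::ab_group_add \<Rightarrow> 'k::field) \<Rightarrow> 'v \<Rightarrow> ('z \<Rightarrow> 'z \<Rightarrow> 'v) \<Rightarrow> 'z \<Rightarrow> 'z \<Rightarrow> 'k" where
  "qa_g q e h a b = polar q (h b a) e / 2"

text \<open>
  \<open>(k, L, q, 1, Z, \<cdot>, h)\<close> with \<open>s\<close>, \<open>t\<close> the scalar multiplications of \<open>L\<close>, \<open>Z\<close>, with \<open>e\<close> for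
  the base point \<open>1\<close> and \<open>m\<close> for the action \<open>\<cdot>\<close> of \<open>L\<close> on \<open>Z\<close>.
\<close>

definition quadrangular_algebra ::
  "('k::field \<Rightarrow> 'v::ab_group_add \<Rightarrow> 'v) \<Rightarrow> ('v \<Rightarrow> 'k) \<Rightarrow> 'v \<Rightarrow>
   ('k \<Rightarrow> 'z::ab_group_add \<Rightarrow> 'z) \<Rightarrow> ('z \<Rightarrow> 'v \<Rightarrow> 'z) \<Rightarrow> ('z \<Rightarrow> 'z \<Rightarrow> 'v) \<Rightarrow> bool" where
  "quadrangular_algebra s q e t m h \<longleftrightarrow>
     quadratic_space s q \<and> anisotropic q \<and> q e = 1 \<and>
     vector_space t \<and> (\<exists>z::'z. z \<noteq> 0) \<and>
     (\<forall>x. Vector_Spaces.linear s t (m x)) \<and> (\<forall>v. Vector_Spaces.linear t t (\<lambda>x. m x v)) \<and>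
     (\<forall>x. Vector_Spaces.linear t s (h x)) \<and> (\<forall>y. Vector_Spaces.linear t s (\<lambda>x. h x y)) \<and>
     (\<forall>x. m x e = x) \<and>
     (\<forall>x v. v \<noteq> 0 \<longrightarrow> m (m x v) (qa_inverse s q e v) = x) \<and>
     (\<forall>x y v. h x (m y v) = h y (m x v) + s (polar q (h x y) e) v) \<and>
     (\<forall>x y v. polar q (h (m x v) y) e = polar q (h x y) v) \<and>
     (\<forall>x v. m x (qa_theta s m h x v) = m (m x (qa_theta s m h x e)) v) \<and>
     (\<forall>x. x \<noteq> 0 \<longrightarrow> qa_theta s m h x e \<noteq> 0)"

text \<open>A field extension \<open>E/k\<close> is given by an embedding \<open>\<iota>\<close> of the field \<open>'k\<close> into the field \<open>'e\<close>.\<close>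

definition separable_quadratic_extension :: "('k::field \<Rightarrow> 'e::field) \<Rightarrow> bool" where
  "separable_quadratic_extension \<iota> \<longleftrightarrow>
     \<iota> \<in> ring_hom ring_of_type_algebra ring_of_type_algebra \<and>
     vector_space.dim (\<lambda>c x. \<iota> c * x) (UNIV :: 'e set) = 2 \<and>
     (\<forall>x. \<exists>p. coprime p (pderiv p) \<and> poly (map_poly \<iota> p) x = 0)"

definition galois_group :: "('k::field \<Rightarrow> 'e::field) \<Rightarrow> ('e \<Rightarrow> 'e) set" where
  "galois_group \<iota> =
     {\<tau> \<in> ring_iso ring_of_type_algebra ring_of_type_algebra. \<forall>c. \<tau> (\<iota> c) = \<iota> c}"

text \<open>
  The norm as the product of the conjugates; this is adequate for the extensions used here since a
  separable quadratic extension is Galois.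
\<close>

definition field_norm :: "('k::field \<Rightarrow> 'e::field) \<Rightarrow> 'e \<Rightarrow> 'k" where
  "field_norm \<iota> x = (THE c. \<iota> c = (\<Prod>\<tau>\<in>galois_group \<iota>. \<tau> x))"

text \<open>\<open>q \<cong> N \<otimes> \<langle>d\<^sub>1, \<dots>, d\<^sub>n\<rangle>\<close>, i.e. \<open>q\<close> is isometric to the orthogonal sum of the forms \<open>d\<^sub>i N\<close> on \<open>E\<^sup>n\<close>.\<close>

definition isometric_to_norm_multiple ::
  "('k::field \<Rightarrow> 'e::field) \<Rightarrow> 'k^'n \<Rightarrow> ('k \<Rightarrow> 'v::ab_group_add \<Rightarrow> 'v) \<Rightarrow> ('v \<Rightarrow> 'k) \<Rightarrow> bool" where
  "isometric_to_norm_multiple \<iota> d s q \<longleftrightarrow>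
     (\<exists>\<phi> :: 'e^'n \<Rightarrow> 'v.
        Vector_Spaces.linear (\<lambda>c x. \<chi> i. \<iota> c * x $ i) s \<phi> \<and> bij \<phi> \<and>
        (\<forall>x. q (\<phi> x) = (\<Sum>i\<in>UNIV. d $ i * field_norm \<iota> (x $ i))))"

definition type_E6 ::
  "('k::field \<Rightarrow> 'e::field) \<Rightarrow> ('k \<Rightarrow> 'v::ab_group_add \<Rightarrow> 'v) \<Rightarrow> ('v \<Rightarrow> 'k) \<Rightarrow> bool" where
  "type_E6 \<iota> s q \<longleftrightarrow>
     separable_quadratic_extension \<iota> \<and>
     (\<exists>d :: 'k^3. d $ 1 = 1 \<and> (\<forall>i. d $ i \<noteq> 0) \<and> isometric_to_norm_multiple \<iota> d s q)"

definition type_E7 ::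
  "('k::field \<Rightarrow> 'e::field) \<Rightarrow> ('k \<Rightarrow> 'v::ab_group_add \<Rightarrow> 'v) \<Rightarrow> ('v \<Rightarrow> 'k) \<Rightarrow> bool" where
  "type_E7 \<iota> s q \<longleftrightarrow>
     separable_quadratic_extension \<iota> \<and>
     (\<exists>d :: 'k^4. d $ 1 = 1 \<and> (\<forall>i. d $ i \<noteq> 0) \<and> isometric_to_norm_multiple \<iota> d s q \<and>
        d $ 2 * d $ 3 * d $ 4 \<notin> range (field_norm \<iota>))"

definition type_E8 ::
  "('k::field \<Rightarrow> 'e::field) \<Rightarrow> ('k \<Rightarrow> 'v::ab_group_add \<Rightarrow> 'v) \<Rightarrow> ('v \<Rightarrow> 'k) \<Rightarrow> bool" where
  "type_E8 \<iota> s q \<longleftrightarrow>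
     separable_quadratic_extension \<iota> \<and>
     (\<exists>d :: 'k^6. d $ 1 = 1 \<and> (\<forall>i. d $ i \<noteq> 0) \<and> isometric_to_norm_multiple \<iota> d s q \<and>
        - (d $ 2 * d $ 3 * d $ 4 * d $ 5 * d $ 6) \<in> range (field_norm \<iota>))"

definition exceptional_type ::
  "('k::field \<Rightarrow> 'v::ab_group_add \<Rightarrow> 'v) \<Rightarrow> ('v \<Rightarrow> 'k) \<Rightarrow> 'v \<Rightarrow>
   ('z::ab_group_add \<Rightarrow> 'v \<Rightarrow> 'z) \<Rightarrow> ('z \<Rightarrow> 'z \<Rightarrow> 'v) \<Rightarrow> ('z \<times> 'k, 'v) root_data" where
  "exceptional_type s q e m h =
     \<lparr>grp13 =
        \<lparr>carrier = UNIV,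
         monoid.mult = (\<lambda>(a1, t1) (a2, t2). (a1 + a2, t1 + t2 + qa_g q e h a1 a2)),
         one = (0, 0)\<rparr>,
      grp24 = additive_group UNIV,
      c13 = (\<lambda>(a1, t1) (a2, t2). h a1 a2),
      c24 = (\<lambda>v1 v2. (0, polar q v1 v2)),
      c14_2 = (\<lambda>(a, t) v. qa_theta s m h a v + s t v),
      c14_3 = (\<lambda>(a, t) v. (m a v, q v * t))\<rparr>"

end

(*
The spin factor k e0 + V + k e1, with u the base point, carries types (a) and (d); the hermitian
2x2 matrices over L, with u the matrix exchanging the two coordinates, carry types (b) and (c).
In (d) the special module is Z x Z, where e0 and e1 act as the two projections and v acts by
(x, y) -> (y v, x v^sigma). This is a special module because (x v) v^sigma = q(v) x =
(x v^sigma) v, and linearizing shows that 2 (j k) acts as j k + k j.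
In (b) and (c) the U-operator is U_x y = x y x, computed in the matrix ring.
The group isomorphisms send v to v in the first case and l to the matrix with rows
(0, l^sigma) and (l, 0) in the second.
*)
theory Submission
  imports Defs "HOL-Analysis.Cartesian_Space"
begin

section \<open>Isomorphic root data\<close>

text \<open>The skew form \<beta> is dictated by the relations: \<open>c13\<close> prescribes it
  between u X_0 and X_0, the group operation prescribes it on X_0 itself, and skew symmetry together
  with the exchange of e_0 and e_1 by u suggests the rest.

  The group axioms for W are never checked on the Jordan side. The listed root data are explicit, so
  their laws are verified there and carried over along the isomorphism. One map serves for both U_1
  and U_3, and one for both U_2 and U_4.

  The recurring difficulty is division by two. The Jordan product contains a half, but neither the
  module Z nor a noncommutative L allows ordinary field arithmetic. Identities are therefore proved
  in doubled form and the factor is cancelled afterwards, or the central element 1/2 is first moved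
  out of all products.\<close>

lemma root_data_isoI:
  assumes wf: "root_data_wf D"
    and f: "f \<in> iso (grp13 D) (grp13 D')" "f (one (grp13 D)) = one (grp13 D')"
    and g: "g \<in> iso (grp24 D) (grp24 D')" "g (one (grp24 D)) = one (grp24 D')"
    and c13: "\<And>a b. \<lbrakk>a \<in> carrier (grp13 D); b \<in> carrier (grp13 D)\<rbrakk> \<Longrightarrow>
      g (c13 D a b) = c13 D' (f a) (f b)"
    and c24: "\<And>v w. \<lbrakk>v \<in> carrier (grp24 D); w \<in> carrier (grp24 D)\<rbrakk> \<Longrightarrow>
      f (c24 D v w) = c24 D' (g v) (g w)"
    and c14: "\<And>a v. \<lbrakk>a \<in> carrier (grp13 D); v \<in> carrier (grp24 D)\<rbrakk> \<Longrightarrow>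
      g (c14_2 D a v) = c14_2 D' (f a) (g v) \<and> f (c14_3 D a v) = c14_3 D' (f a) (g v)"
  shows "root_data_iso D D'"
proof -
  have grp: "group (grp13 D)" "group (grp24 D)"
    using wf by (auto simp: root_data_wf_def)
  \<comment> \<open>The transported group carries the image of the unit as its unit; the two
    hypotheses on \<open>one\<close> identify it with the unit stored in \<open>D'\<close>.\<close>
  have "group (grp13 D')" "group (grp24 D')"
    using group.iso_imp_img_group[OF grp(1) f(1)] group.iso_imp_img_group[OF grp(2) g(1)] f(2) g(2)
    by simp_all
  moreover have im: "carrier (grp13 D') = f ` carrier (grp13 D)" "carrier (grp24 D') = g ` carrier (grp24 D)"
    using f(1) g(1) by (auto simp: iso_iff)
  ultimately have "root_data_wf D'"
    using wf unfolding root_data_wf_def im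
    by (auto simp flip: c13 c24 simp: c14[THEN conjunct1, symmetric] c14[THEN conjunct2, symmetric])
  then show ?thesis
    unfolding root_data_iso_def using wf f(1) g(1) c13 c24 c14
    by (intro conjI bexI[of _ f] bexI[of _ g]) auto
qed

text \<open>The relations are pulled back along the inverse maps. An inverse undoes its map only on
  the carrier, so the closure part of \<open>root_data_wf\<close> enters in each relation.\<close>

lemma root_data_iso_sym:
  assumes "root_data_iso D D'"
  shows "root_data_iso D' D"
proof -
  obtain f1 f2 f3 f4 where wf: "root_data_wf D" "root_data_wf D'"
    and iso: "f1 \<in> iso (grp13 D) (grp13 D')" "f2 \<in> iso (grp24 D) (grp24 D')"
      "f3 \<in> iso (grp13 D) (grp13 D')" "f4 \<in> iso (grp24 D) (grp24 D')"
    and c13: "\<forall>a\<in>carrier (grp13 D). \<forall>b\<in>carrier (grp13 D). f2 (c13 D a b) = c13 D' (f1 a) (f3 b)"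
    and c24: "\<forall>v\<in>carrier (grp24 D). \<forall>w\<in>carrier (grp24 D). f3 (c24 D v w) = c24 D' (f2 v) (f4 w)"
    and c14: "\<forall>a\<in>carrier (grp13 D). \<forall>v\<in>carrier (grp24 D).
      f2 (c14_2 D a v) = c14_2 D' (f1 a) (f4 v) \<and> f3 (c14_3 D a v) = c14_3 D' (f1 a) (f4 v)"
    using assms unfolding root_data_iso_def by (elim conjE bexE) (rule that; assumption)
  have grp: "group (grp13 D)" "group (grp24 D)"
    using wf(1) by (auto simp: root_data_wf_def)
  define g1 where "g1 = inv_into (carrier (grp13 D)) f1"
  define g2 where "g2 = inv_into (carrier (grp24 D)) f2"
  define g3 where "g3 = inv_into (carrier (grp13 D)) f3"
  define g4 where "g4 = inv_into (carrier (grp24 D)) f4"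
  note g_defs = g1_def g2_def g3_def g4_def
  have giso: "g1 \<in> iso (grp13 D') (grp13 D)" "g2 \<in> iso (grp24 D') (grp24 D)"
      "g3 \<in> iso (grp13 D') (grp13 D)" "g4 \<in> iso (grp24 D') (grp24 D)"
    unfolding g_defs using grp iso by (auto intro: group.iso_set_sym)
  have gmem: "\<And>a. a \<in> carrier (grp13 D') \<Longrightarrow> g1 a \<in> carrier (grp13 D)"
      "\<And>a. a \<in> carrier (grp24 D') \<Longrightarrow> g2 a \<in> carrier (grp24 D)"
      "\<And>a. a \<in> carrier (grp13 D') \<Longrightarrow> g3 a \<in> carrier (grp13 D)"
      "\<And>a. a \<in> carrier (grp24 D') \<Longrightarrow> g4 a \<in> carrier (grp24 D)"
    using giso by (auto simp: iso_iff)
  have gf: "\<And>a. a \<in> carrier (grp24 D) \<Longrightarrow> g2 (f2 a) = a"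
      "\<And>a. a \<in> carrier (grp13 D) \<Longrightarrow> g3 (f3 a) = a"
    unfolding g_defs using iso by (auto simp: iso_iff)
  have fg: "\<And>a. a \<in> carrier (grp13 D') \<Longrightarrow> f1 (g1 a) = a"
      "\<And>a. a \<in> carrier (grp24 D') \<Longrightarrow> f2 (g2 a) = a"
      "\<And>a. a \<in> carrier (grp13 D') \<Longrightarrow> f3 (g3 a) = a"
      "\<And>a. a \<in> carrier (grp24 D') \<Longrightarrow> f4 (g4 a) = a"
    unfolding g_defs using iso by (auto simp: iso_iff f_inv_into_f)
  note D_closed = wf(1)[unfolded root_data_wf_def]
  have "g2 (c13 D' a b) = c13 D (g1 a) (g3 b)"
    if "a \<in> carrier (grp13 D')" "b \<in> carrier (grp13 D')" for a b
    using c13[rule_format, of "g1 a" "g3 b"] that D_closed by (metis gf(1) fg(1,3) gmem(1,3))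
  moreover have "g3 (c24 D' v w) = c24 D (g2 v) (g4 w)"
    if "v \<in> carrier (grp24 D')" "w \<in> carrier (grp24 D')" for v w
    using c24[rule_format, of "g2 v" "g4 w"] that D_closed by (metis gf(2) fg(2,4) gmem(2,4))
  moreover have "g2 (c14_2 D' a v) = c14_2 D (g1 a) (g4 v) \<and> g3 (c14_3 D' a v) = c14_3 D (g1 a) (g4 v)"
    if "a \<in> carrier (grp13 D')" "v \<in> carrier (grp24 D')" for a v
    using c14[rule_format, of "g1 a" "g4 v"] that D_closed by (metis gf(1,2) fg(1,4) gmem(1,4))
  ultimately show ?thesis
    unfolding root_data_iso_def using wf giso
    by (intro conjI bexI[of _ g1] bexI[of _ g2] bexI[of _ g3] bexI[of _ g4]) auto
qed

text \<open>Apart from the four parametrizations, a root group sequence speaks only about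
  \<open>U\<close> and its subgroups. Replacing each parametrization by its composite with the
  isomorphism therefore suffices.\<close>

lemma root_group_sequence_transport:
  assumes "root_data_iso D D'" "root_group_sequence U U1 U2 U3 U4 D'"
  shows "root_group_sequence U U1 U2 U3 U4 D"
proof -
  obtain f1 f2 f3 f4 where
    iso: "f1 \<in> iso (grp13 D) (grp13 D')" "f2 \<in> iso (grp24 D) (grp24 D')"
      "f3 \<in> iso (grp13 D) (grp13 D')" "f4 \<in> iso (grp24 D) (grp24 D')"
    and rel: "\<forall>a\<in>carrier (grp13 D). \<forall>b\<in>carrier (grp13 D). f2 (c13 D a b) = c13 D' (f1 a) (f3 b)"
      "\<forall>v\<in>carrier (grp24 D). \<forall>w\<in>carrier (grp24 D). f3 (c24 D v w) = c24 D' (f2 v) (f4 w)"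
      "\<forall>a\<in>carrier (grp13 D). \<forall>v\<in>carrier (grp24 D). f2 (c14_2 D a v) = c14_2 D' (f1 a) (f4 v) \<and>
        f3 (c14_3 D a v) = c14_3 D' (f1 a) (f4 v)"
    using assms(1) unfolding root_data_iso_def by (elim conjE bexE) (rule that; assumption)
  obtain x1 x2 x3 x4 where
    x: "x1 \<in> iso (grp13 D') (U\<lparr>carrier := U1\<rparr>)" "x2 \<in> iso (grp24 D') (U\<lparr>carrier := U2\<rparr>)"
      "x3 \<in> iso (grp13 D') (U\<lparr>carrier := U3\<rparr>)" "x4 \<in> iso (grp24 D') (U\<lparr>carrier := U4\<rparr>)"
    and xrel: "\<forall>a\<in>carrier (grp13 D'). \<forall>b\<in>carrier (grp13 D').
        commutator U (x1 a) (inv\<^bsub>U\<^esub> x3 b) = x2 (c13 D' a b)"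
      "\<forall>v\<in>carrier (grp24 D'). \<forall>w\<in>carrier (grp24 D').
        commutator U (x2 v) (inv\<^bsub>U\<^esub> x4 w) = x3 (c24 D' v w)"
      "\<forall>a\<in>carrier (grp13 D'). \<forall>v\<in>carrier (grp24 D').
        commutator U (x1 a) (inv\<^bsub>U\<^esub> x4 v) = x2 (c14_2 D' a v) \<otimes>\<^bsub>U\<^esub> x3 (c14_3 D' a v)"
    using assms(2) unfolding root_group_sequence_def by (elim conjE bexE) (rule that; assumption)
  have fmem: "\<And>a. a \<in> carrier (grp13 D) \<Longrightarrow> f1 a \<in> carrier (grp13 D')"
      "\<And>a. a \<in> carrier (grp24 D) \<Longrightarrow> f2 a \<in> carrier (grp24 D')"
      "\<And>a. a \<in> carrier (grp13 D) \<Longrightarrow> f3 a \<in> carrier (grp13 D')"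
      "\<And>a. a \<in> carrier (grp24 D) \<Longrightarrow> f4 a \<in> carrier (grp24 D')"
    using iso by (auto simp: iso_iff)
  have y: "x1 \<circ> f1 \<in> iso (grp13 D) (U\<lparr>carrier := U1\<rparr>)" "x2 \<circ> f2 \<in> iso (grp24 D) (U\<lparr>carrier := U2\<rparr>)"
      "x3 \<circ> f3 \<in> iso (grp13 D) (U\<lparr>carrier := U3\<rparr>)" "x4 \<circ> f4 \<in> iso (grp24 D) (U\<lparr>carrier := U4\<rparr>)"
    using iso x by (auto intro: iso_set_trans)
  have rel': "\<forall>a\<in>carrier (grp13 D). \<forall>b\<in>carrier (grp13 D).
        commutator U ((x1 \<circ> f1) a) (inv\<^bsub>U\<^esub> (x3 \<circ> f3) b) = (x2 \<circ> f2) (c13 D a b)"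
    "\<forall>v\<in>carrier (grp24 D). \<forall>w\<in>carrier (grp24 D).
        commutator U ((x2 \<circ> f2) v) (inv\<^bsub>U\<^esub> (x4 \<circ> f4) w) = (x3 \<circ> f3) (c24 D v w)"
    "\<forall>a\<in>carrier (grp13 D). \<forall>v\<in>carrier (grp24 D).
        commutator U ((x1 \<circ> f1) a) (inv\<^bsub>U\<^esub> (x4 \<circ> f4) v) =
          (x2 \<circ> f2) (c14_2 D a v) \<otimes>\<^bsub>U\<^esub> (x3 \<circ> f3) (c14_3 D a v)"
    using rel xrel fmem by auto
  show ?thesis
    using assms(2) y rel' unfolding root_group_sequence_def
    by (intro conjI bexI[of _ "x1 \<circ> f1"] bexI[of _ "x2 \<circ> f2"] bexI[of _ "x3 \<circ> f3"] bexI[of _ "x4 \<circ> f4"])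
      (elim conjE; assumption)+
qed

lemma root_group_sequence_iso:
  assumes "root_data_iso D D'"
  shows "root_group_sequence U U1 U2 U3 U4 D \<longleftrightarrow> root_group_sequence U U1 U2 U3 U4 D'"
proof
  show "root_group_sequence U U1 U2 U3 U4 D \<Longrightarrow> root_group_sequence U U1 U2 U3 U4 D'"
    by (rule root_group_sequence_transport[OF root_data_iso_sym[OF assms]])
qed (rule root_group_sequence_transport[OF assms])

section \<open>The zero module, and one half in a field\<close>

lemma zero_module_simps [simp]:
  "carrier zero_module = {()}" "x \<oplus>\<^bsub>zero_module\<^esub> y = ()" "\<zero>\<^bsub>zero_module\<^esub> = ()"
  "c \<odot>\<^bsub>zero_module\<^esub> x = ()"
  by (simp_all add: zero_module_def)

lemma special_module_zero_module:
  assumes "cring K"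
  shows "special_module K J zero_module (\<lambda>_ _. ())"
proof -
  have "abelian_group zero_module"
    by (rule abelian_groupI) auto
  then have "Module.module K zero_module"
    using assms by (intro moduleI) auto
  then show ?thesis
    by (auto simp: special_module_def bilinear_on_def linear_on_def)
qed

lemma bilinear_on_zero_module:
  assumes "Module.module K J"
  shows "bilinear_on K zero_module zero_module J (\<lambda>_ _. \<zero>\<^bsub>J\<^esub>)"
proof -
  interpret Module.module K J by fact
  show ?thesis
    by (auto simp: bilinear_on_def linear_on_def)
qed

lemma special_module_0_zero_module: "special_module_0 zero_module (\<lambda>_ _. ()) e0 = {()}"
  by (auto simp: special_module_0_def)

lemma two_neq_zero_of_CHAR:
  assumes "CHAR('a::division_ring) \<noteq> 2"
  shows "(2::'a) \<noteq> 0"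
proof
  assume "(2::'a) = 0"
  then have "CHAR('a) dvd 2"
    by (metis of_nat_eq_0_iff_char_dvd of_nat_numeral)
  then have "CHAR('a) \<in> {1, 2}"
    using dvd_imp_le[of "CHAR('a)" 2] by (auto simp: le_Suc_eq numeral_2_eq_2)
  \<comment> \<open>The value 1 is excluded because it would make the division ring trivial.\<close>
  then show False
    using assms by simp
qed

text \<open>\<open>half\<close> is an inverse relative to a carrier; this characterisation serves
  both for the field of a type and for the symmetric centre of a skew field.\<close>

lemma half_eq:
  assumes "field K" "y \<in> carrier K"
    "y \<otimes>\<^bsub>K\<^esub> (\<one>\<^bsub>K\<^esub> \<oplus>\<^bsub>K\<^esub> \<one>\<^bsub>K\<^esub>) = \<one>\<^bsub>K\<^esub>"
  shows "half K = y"
proof -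
  interpret field K by fact
  show ?thesis
    unfolding half_def using assms(2,3) by (metis comm_inv_char m_comm one_closed add.m_closed)
qed

lemma ring_of_type_algebra_simps:
  "carrier ring_of_type_algebra = UNIV"
  "x \<otimes>\<^bsub>ring_of_type_algebra\<^esub> y = x * y"
  "x \<oplus>\<^bsub>ring_of_type_algebra\<^esub> y = x + y"
  "\<one>\<^bsub>ring_of_type_algebra\<^esub> = 1" "\<zero>\<^bsub>ring_of_type_algebra\<^esub> = 0"
  by (simp_all add: ring_of_type_algebra_def)

lemma field_char_not_2_ring_of_type_algebra:
  assumes "(2::'k::field) \<noteq> 0"
  shows "field_char_not_2 (ring_of_type_algebra :: 'k ring)"
  using assms by (auto simp: field_char_not_2_def ring_of_type_algebra_simps)

lemma half_ring_of_type_algebra: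
  assumes "(2::'k::field) \<noteq> 0"
  shows "half (ring_of_type_algebra :: 'k ring) = 1 / 2"
  by (rule half_eq) (use assms in \<open>auto simp: ring_of_type_algebra_simps\<close>)

lemma group_additive_group:
  assumes "0 \<in> S" "\<And>x y. \<lbrakk>x \<in> S; y \<in> S\<rbrakk> \<Longrightarrow> x + y \<in> S" "\<And>x. x \<in> S \<Longrightarrow> - x \<in> S"
  shows "group (additive_group S)"
  by (rule groupI) (use assms in \<open>auto simp: additive_group_def add.assoc intro!: bexI[of _ "- x" for x]\<close>)

lemma abelian_group_of_plus:
  fixes M :: "('k, 'm::ab_group_add) module"
  assumes "add M = (+)" "\<zero>\<^bsub>M\<^esub> = 0" "0 \<in> carrier M"
    "\<And>x y. \<lbrakk>x \<in> carrier M; y \<in> carrier M\<rbrakk> \<Longrightarrow> x + y \<in> carrier M"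
    "\<And>x. x \<in> carrier M \<Longrightarrow> - x \<in> carrier M"
  shows "abelian_group M"
  by (rule abelian_groupI) (use assms in \<open>auto simp: add_ac intro!: bexI[of _ "- x" for x]\<close>)

section \<open>Spin factors\<close>

text \<open>The common setting of types (a) and (d), which differ in the special module placed over
  the same kind of algebra.\<close>

locale spin = vector_space s for s :: "'k::field \<Rightarrow> 'v::ab_group_add \<Rightarrow> 'v" +
  fixes q :: "'v \<Rightarrow> 'k" and e :: 'v
  assumes two: "(2::'k) \<noteq> 0"
    and quadratic: "quadratic_space s q"
    and aniso: "q v = 0 \<Longrightarrow> v = 0"
    and base: "q e = 1"
begin

abbreviation J where "J \<equiv> spin_factor s q"
abbreviation K :: "'k ring" where "K \<equiv> ring_of_type_algebra"

lemma polar_add [simp]: "polar q v (w + w') = polar q v w + polar q v w'"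
    "polar q (v + v') w = polar q v w + polar q v' w"
  and polar_scale [simp]: "polar q v (s c w) = c * polar q v w" "polar q (s c v) w = c * polar q v w"
  using quadratic unfolding quadratic_space_def Vector_Spaces.linear_iff by auto

lemma polar_commute: "polar q v w = polar q w v"
  by (simp add: polar_def add.commute)

lemma q_scale: "q (s c v) = c\<^sup>2 * q v"
  using quadratic unfolding quadratic_space_def by auto

lemma q_zero [simp]: "q 0 = 0"
  using q_scale[of 0 0] by simp

lemma polar_zero [simp]: "polar q v 0 = 0" "polar q 0 v = 0"
  using polar_scale(1)[where c=0 and v=v and w=0] polar_scale(2)[where c=0 and v=0 and w=v] by simp_all

lemma polar_minus [simp]: "polar q v (- w) = - polar q v w" "polar q (- v) w = - polar q v w"
  using polar_scale(1)[where c="- 1" and v=v and w=w] polar_scale(2)[where c="- 1" and v=v and w=w] by simp_all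

lemma polar_diff [simp]: "polar q v (w - w') = polar q v w - polar q v w'"
  "polar q (v - v') w = polar q v w - polar q v' w"
  by (simp_all only: diff_conv_add_uminus polar_add polar_minus)

lemma polar_self [simp]: "polar q v v = 2 * q v"
  using q_scale[of 2 v] scale_left_distrib[of 1 1 v] by (simp add: polar_def)

lemma spin_simps [simp]:
  "carrier J = UNIV"
  "(a0, v, a1) \<otimes>\<^bsub>J\<^esub> (b0, w, b1) = (a0 * b0 + polar q v w / 2,
     s ((a0 + a1) / 2) w + s ((b0 + b1) / 2) v, a1 * b1 + polar q v w / 2)"
  "\<one>\<^bsub>J\<^esub> = (1, 0, 1)" "\<zero>\<^bsub>J\<^esub> = (0, 0, 0)"
  "(a0, v, a1) \<oplus>\<^bsub>J\<^esub> (b0, w, b1) = (a0 + b0, v + w, a1 + b1)"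
  "c \<odot>\<^bsub>J\<^esub> (a0, v, a1) = (c * a0, s c v, c * a1)"
  by (simp_all add: spin_factor_def)

lemma module_spin: "Module.module K J"
proof (rule moduleI)
  show "cring K"
    by (rule cring_from_type_algebra)
  show "abelian_group J"
    by (rule abelian_groupI)
      (auto simp: add_ac intro!: exI[of _ "- x" for x])
qed (auto simp: ring_of_type_algebra_simps algebra_simps scale_left_distrib scale_right_distrib)

lemma a_inv_spin [simp]: "\<ominus>\<^bsub>J\<^esub> (a, v, b) = (- a, - v, - b)"
proof -
  interpret Module.module K J by (rule module_spin)
  show ?thesis
    by (rule M.minus_equality) auto
qed

lemma a_minus_spin [simp]: "(a, v, b) \<ominus>\<^bsub>J\<^esub> (c, w, d) = (a - c, v - w, b - d)"
  by (simp add: a_minus_def)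

lemma square_spin: "(a, v, b) \<otimes>\<^bsub>J\<^esub> (a, v, b) = (a\<^sup>2 + q v, s (a + b) v, b\<^sup>2 + q v)"
  using two by (simp add: power2_eq_square flip: scale_left_distrib)

lemma scale_double: "s c v + s c v = s (2 * c) v"
  by (metis mult_2 scale_left_distrib)

lemma bilinear_spin: "bilinear_on K J J J (monoid.mult J)"
  unfolding bilinear_on_def linear_on_def
  by (auto simp: field_simps add_divide_distrib scale_left_distrib scale_right_distrib)

lemma four: "(4::'k) \<noteq> 0"
proof -
  have "(4::'k) = 2 * 2" by simp
  then show ?thesis using two by (metis mult_eq_0_iff)
qed

text \<open>The middle components of both sides are combinations of v and w, so comparing their
  coefficients and the two outer components leaves only identities in the field.\<close>

lemma spin_jordan_identity:
  "((x \<otimes>\<^bsub>J\<^esub> x) \<otimes>\<^bsub>J\<^esub> y) \<otimes>\<^bsub>J\<^esub> x = (x \<otimes>\<^bsub>J\<^esub> x) \<otimes>\<^bsub>J\<^esub> (y \<otimes>\<^bsub>J\<^esub> x)"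
proof (cases x; cases y)
  fix a v b c w d assume xy: "x = (a, v, b)" "y = (c, w, d)"
  define f Q A B S where "f = polar q v w" "Q = q v" "A = a\<^sup>2 + Q" "B = b\<^sup>2 + Q" "S = a + b"
  note defs = this
  \<comment> \<open>\<open>P\<close> and \<open>R\<close> are the outer components of (x x) y, and
    \<open>F\<close> is the value of the polar form on its middle component and v.\<close>
  define P R F where "P = A * c + S * f / 2" "R = B * d + S * f / 2" "F = (A + B) / 2 * f + (c + d) * S * Q"
  note defs' = this
  have "(8::'k) = 2 * 4" "(32::'k) = 2 * 4 * 4"
    by simp_all
  then have nz: "(4::'k) \<noteq> 0" "(8::'k) \<noteq> 0" "(32::'k) \<noteq> 0"
    using two four by (metis mult_eq_0_iff)+
  have f': "polar q w v = f"
    by (simp add: defs polar_commute)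
  have sq: "x \<otimes>\<^bsub>J\<^esub> x = (A, s S v, B)"
    unfolding xy square_spin by (simp add: defs)
  have left: "(x \<otimes>\<^bsub>J\<^esub> x) \<otimes>\<^bsub>J\<^esub> y = (P, s ((A + B) / 2) w + s ((c + d) / 2 * S) v, R)"
    unfolding sq unfolding xy by (simp add: defs'(1,2) flip: defs(1))
  have "((x \<otimes>\<^bsub>J\<^esub> x) \<otimes>\<^bsub>J\<^esub> y) \<otimes>\<^bsub>J\<^esub> x =
      (P * a + F / 2, s ((P + R) / 2 + S / 2 * ((c + d) / 2 * S)) v + s (S / 2 * ((A + B) / 2)) w, R * b + F / 2)"
    unfolding left unfolding xy
    by (simp add: f' defs'(3) scale_right_distrib scale_left_distrib flip: defs(2,5))
  moreover have "(x \<otimes>\<^bsub>J\<^esub> x) \<otimes>\<^bsub>J\<^esub> (y \<otimes>\<^bsub>J\<^esub> x) =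
      (A * (c * a + f / 2) + S * ((c + d) * Q + S / 2 * f) / 2,
       s ((A + B) / 2 * ((c + d) / 2) + (c * a + d * b + f) / 2 * S) v + s ((A + B) / 2 * (S / 2)) w,
       B * (d * b + f / 2) + S * ((c + d) * Q + S / 2 * f) / 2)"
    unfolding sq unfolding xy using two
    by (simp add: f' scale_right_distrib flip: defs(1,2,5)) (simp add: scale_left_distrib algebra_simps)
  moreover have "P * a + F / 2 = A * (c * a + f / 2) + S * ((c + d) * Q + S / 2 * f) / 2"
    using two nz by (simp add: defs(3-5) defs' field_simps power2_eq_square)
  moreover have "R * b + F / 2 = B * (d * b + f / 2) + S * ((c + d) * Q + S / 2 * f) / 2"
    using two nz by (simp add: defs(3-5) defs' field_simps power2_eq_square)
  moreover have "(P + R) / 2 + S / 2 * ((c + d) / 2 * S) = (A + B) / 2 * ((c + d) / 2) + (c * a + d * b + f) / 2 * S"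
    using two nz by (simp add: defs(3-5) defs' field_simps power2_eq_square)
  ultimately show ?thesis
    by (simp add: mult.commute)
qed

lemma jordan_algebra_spin: "jordan_algebra K J"
  unfolding jordan_algebra_def
  using field_char_not_2_ring_of_type_algebra[OF two] module_spin bilinear_spin two spin_jordan_identity
  by (auto simp: polar_commute mult.commute)

text \<open>Two test elements suffice. U_x e_0 has outer components a^2 and q(v), so a and, by
  anisotropy, v vanish; then U_x 1 = x^2 kills b.\<close>

lemma nondegenerate_spin: "jordan_nondegenerate J"
  unfolding jordan_nondegenerate_def
proof safe
  fix a v b assume *: "\<forall>y\<in>carrier J. jordan_U J (a, v, b) y = \<zero>\<^bsub>J\<^esub>"
  have "jordan_U J (a, v, b) \<one>\<^bsub>J\<^esub> = (a, v, b) \<otimes>\<^bsub>J\<^esub> (a, v, b)"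
  proof -
    have h: "(4 * a + 4 * b) / 2 = (a + b) + (a + b)"
      using two by (simp add: field_simps)
    show ?thesis
      using two four unfolding jordan_U_def square_spin
      by (simp add: scale_double power2_eq_square) (simp add: h scale_left_distrib flip: scale_double)
  qed
  then have sq: "a\<^sup>2 + q v = 0" "s (a + b) v = 0" "b\<^sup>2 + q v = 0"
    using * unfolding square_spin by auto
  have "jordan_U J (a, v, b) (1, 0, 0) = (a\<^sup>2, s a v, q v)"
    using two four unfolding jordan_U_def square_spin
    by (simp add: scale_right_distrib scale_double power2_eq_square flip: scale_left_diff_distrib scale_left_distrib)
  with * have "a = 0" "q v = 0" by auto
  then show "(a, v, b) = \<zero>\<^bsub>J\<^esub>"
    using sq aniso by auto
qed

lemma idempotents_spin: "supplementary_proper_idempotents J spin_e0 spin_e1"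
  by (simp add: supplementary_proper_idempotents_def spin_e0_def spin_e1_def)

lemma peirce_half_spin: "peirce J spin_e1 (half K) = range (\<lambda>v. (0, v, 0))"
proof -
  \<comment> \<open>The \<open>e1\<close>-component b of an element of J_{1/2} satisfies b = b/2,
    and this forces b = 0 once 2 and 1 differ.\<close>
  have "(2::'k) \<noteq> 1"
    by (metis one_add_one add_cancel_left_left zero_neq_one)
  then show ?thesis
    unfolding peirce_def half_ring_of_type_algebra[OF two] using two
    by (auto simp: spin_e1_def field_simps)
qed

lemma peirce_zero_spin: "peirce J spin_e1 \<zero>\<^bsub>K\<^esub> = range (\<lambda>a. (a, 0, 0))"
  unfolding peirce_def using two by (auto simp: spin_e1_def ring_of_type_algebra_simps)

text \<open>Since v^2 = q(v) 1 with q(v) nonzero by anisotropy, the inverse of v is v divided by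
  q(v).\<close>

lemma invertible_spin:
  assumes "v \<noteq> 0"
  shows "jordan_invertible J (0, v, 0)"
proof -
  have "q v \<noteq> 0" using assms aniso by auto
  then show ?thesis
    using two unfolding jordan_invertible_def square_spin
    by (intro bexI[of _ "(0, s (1 / q v) v, 0)"]) (simp_all add: scale_double)
qed

text \<open>Collects everything that depends on the algebra alone. The base point enters as u
  because its square is q(e) 1 = 1.\<close>

lemma M_input_spin:
  assumes "special_module K J M act" "bilinear_on K M M J \<beta>"
    "\<And>x y. \<lbrakk>x \<in> carrier M; y \<in> carrier M\<rbrakk> \<Longrightarrow> \<beta> x y = \<ominus>\<^bsub>J\<^esub> \<beta> y x"
  shows "M_input K J spin_e0 spin_e1 (0, e, 0) M act \<beta>"
proof -
  have "\<forall>v\<in>range (\<lambda>v. (0, v, 0)). v \<noteq> \<zero>\<^bsub>J\<^esub> \<longrightarrow> jordan_invertible J v"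
    using invertible_spin by auto
  moreover have "(0, e, 0) \<otimes>\<^bsub>J\<^esub> (0, e, 0) = \<one>\<^bsub>J\<^esub>"
    unfolding square_spin by (simp add: base)
  ultimately show ?thesis
    unfolding M_input_def peirce_half_spin
    using assms jordan_algebra_spin nondegenerate_spin idempotents_spin by blast
qed

text \<open>U_u carries J_0 to J_1 and U_v carries J_1 back with the factor q(v); together they
  produce the term q(v) t of the relations.\<close>

lemma U_base_spin: "jordan_U J (0, e, 0) (a, 0, 0) = (0, 0, a)"
  using two unfolding jordan_U_def square_spin by (simp add: base)

lemma U_half_spin: "jordan_U J (0, v, 0) (0, 0, a) = (q v * a, 0, 0)"
  using two unfolding jordan_U_def square_spin by (simp add: base)

end

section \<open>Type (a): quadratic forms\<close>

context spin
begin

lemma M_input_spin_zero: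
  "M_input K J spin_e0 spin_e1 (0, e, 0) zero_module (\<lambda>_ _. ()) (\<lambda>_ _. \<zero>\<^bsub>J\<^esub>)"
  by (rule M_input_spin)
    (use special_module_zero_module[OF cring_from_type_algebra] bilinear_on_zero_module[OF module_spin] in auto)

lemma root_data_wf_quadratic: "root_data_wf (quadratic_form_type s q)"
  by (auto simp: root_data_wf_def quadratic_form_type_def intro!: group_additive_group)
    (simp_all add: additive_group_def)

text \<open>The factors 2 in Construction (M) absorb the halves of the spin product: 2 (v w) e_0 =
  f(v,w) e_0 and 2 (t e_1) v = t v.\<close>

lemma root_data_iso_quadratic:
  "root_data_iso (quadratic_form_type s q)
     (construction_M K J spin_e0 spin_e1 (0, e, 0) zero_module (\<lambda>_ _. ()) (\<lambda>_ _. \<zero>\<^bsub>J\<^esub>))"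
    (is "root_data_iso ?D ?D'")
proof (rule root_data_isoI)
  show "root_data_wf ?D"
    by (rule root_data_wf_quadratic)
  let ?f = "\<lambda>t. ((), (t, 0, 0))" and ?g = "\<lambda>v. (0, v, 0)"
  show "?f \<in> iso (grp13 ?D) (grp13 ?D')"
    unfolding construction_M_def quadratic_form_type_def root_data.simps peirce_zero_spin
      special_module_0_zero_module
    by (auto simp: iso_iff hom_def inj_on_def additive_group_def)
  show "?g \<in> iso (grp24 ?D) (grp24 ?D')"
    unfolding construction_M_def quadratic_form_type_def root_data.simps peirce_half_spin
    by (auto simp: iso_iff hom_def inj_on_def additive_group_def)
qed (use two in \<open>auto simp: construction_M_def quadratic_form_type_def additive_group_def
      U_base_spin U_half_spin spin_e0_def scale_double\<close>)

end

section \<open>Quadrangular algebras\<close>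

definition square_module :: "('k \<Rightarrow> 'z::ab_group_add \<Rightarrow> 'z) \<Rightarrow> ('k, 'z \<times> 'z) module" where
  "square_module t = \<lparr>carrier = UNIV, monoid.mult = undefined, one = undefined, zero = 0, add = (+),
     module.smult = (\<lambda>c (x, y). (t c x, t c y))\<rparr>"

locale quadrangular = spin s q e
  for s :: "'k::field \<Rightarrow> 'v::ab_group_add \<Rightarrow> 'v" and q :: "'v \<Rightarrow> 'k" and e :: 'v +
  fixes t :: "'k \<Rightarrow> 'z::ab_group_add \<Rightarrow> 'z" and m :: "'z \<Rightarrow> 'v \<Rightarrow> 'z" and h :: "'z \<Rightarrow> 'z \<Rightarrow> 'v"
  assumes qa: "quadrangular_algebra s q e t m h"
begin

sublocale Z: vector_space t
  using qa by (simp add: quadrangular_algebra_def)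

abbreviation \<sigma> where "\<sigma> \<equiv> qa_sigma s q e"

lemma m_linear [simp]:
  "m x (v + w) = m x v + m x w" "m x (s c v) = t c (m x v)"
  "m (x + y) v = m x v + m y v" "m (t c x) v = t c (m x v)"
  and h_linear [simp]:
  "h x (y + y') = h x y + h x y'" "h x (t c y) = s c (h x y)"
  "h (x + x') y = h x y + h x' y" "h (t c x) y = s c (h x y)"
  using qa unfolding quadrangular_algebra_def Vector_Spaces.linear_iff by auto

lemma m_zero [simp]: "m x 0 = 0" "m 0 v = 0"
  and h_zero [simp]: "h x 0 = 0" "h 0 y = 0"
  using m_linear(2)[where c=0 and x=x and v=0] m_linear(4)[where c=0 and x=0 and v=v]
    h_linear(2)[where c=0 and x=x and y=0] h_linear(4)[where c=0 and x=0 and y=y] by simp_all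

lemma m_base [simp]: "m x e = x"
  using qa unfolding quadrangular_algebra_def by auto

lemma sig_add: "\<sigma> (v + w) = \<sigma> v + \<sigma> w"
  and sig_scale: "\<sigma> (s c v) = s c (\<sigma> v)"
  and sig_base [simp]: "\<sigma> e = e"
  and sig_zero [simp]: "\<sigma> 0 = 0"
  and sig_sig [simp]: "\<sigma> (\<sigma> v) = v"
  using scale_left_distrib[of 1 1 e]
  by (simp_all add: qa_sigma_def scale_left_distrib scale_right_diff_distrib scale_left_diff_distrib base mult.commute)

text \<open>As q(1) = 1, \<sigma> is minus the reflection along the base point, hence an
  isometry.\<close>

lemma polar_sig [simp]: "polar q (\<sigma> v) (\<sigma> w) = polar q v w"
  by (simp add: qa_sigma_def base algebra_simps polar_commute[of _ e])

lemma q_sig [simp]: "q (\<sigma> v) = q v"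
  using polar_sig[of v v] two by simp

text \<open>The inverse axiom with its denominator cleared. In this form it also holds for v = 0 and
  can be polarised.\<close>

lemma m_sig: "m (m x v) (\<sigma> v) = t (q v) x"
proof (cases "v = 0")
  case False
  then have "m (m x v) (qa_inverse s q e v) = x"
    using qa unfolding quadrangular_algebra_def by auto
  then have "t (q v) (t (1 / q v) (m (m x v) (\<sigma> v))) = t (q v) x"
    by (simp add: qa_inverse_def)
  moreover have "q v \<noteq> 0"
    using False aniso by auto
  ultimately show ?thesis by simp
qed (use q_scale[of 0 0] in simp)

lemma q_add: "q (v + w) = q v + q w + polar q v w"
  by (simp add: polar_def)

lemma m_sig_polar: "m (m x v) (\<sigma> w) + m (m x w) (\<sigma> v) = t (polar q v w) x"
  using m_sig[of x "v + w"]
  by (simp add: sig_add m_sig[of x v] m_sig[of x w] q_add Z.scale_left_distrib algebra_simps)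

text \<open>The two coordinates of Z x Z meet v and its conjugate in opposite orders, so both
  versions are needed. This one follows from the other because \<sigma> is an involutive
  isometry.\<close>

lemma sig_m_polar: "m (m x (\<sigma> v)) w + m (m x (\<sigma> w)) v = t (polar q v w) x"
  using m_sig_polar[of x "\<sigma> v" "\<sigma> w"] by simp

lemma h_m: "h x (m y v) = h y (m x v) + s (polar q (h x y) e) v"
  using qa unfolding quadrangular_algebra_def by blast

text \<open>The axiom for h(x, y v) at v = 1 compares h(x,y) with h(y,x); pairing with the base
  point and using f(1,1) = 2 gives the sign.\<close>

lemma polar_h_skew: "polar q (h x y) e = - polar q (h y x) e"
proof -
  have "h x y = h y x + s (polar q (h x y) e) e"
    using h_m[of x y e] by simp
  then have "polar q (h x y) e = polar q (h y x + s (polar q (h x y) e) e) e"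
    by simp
  also have "\<dots> = polar q (h y x) e + 2 * polar q (h x y) e"
    by (simp add: base)
  also have "\<dots> = (polar q (h x y) e + polar q (h y x) e) + polar q (h x y) e"
    by (simp only: mult_2 add_ac)
  finally show ?thesis
    by (metis add_cancel_right_left eq_neg_iff_add_eq_0)
qed

text \<open>Skew forms are alternating here; this is what makes the group of type (d) have the plain
  negatives as inverses.\<close>

lemma polar_h_self [simp]: "polar q (h x x) e = 0"
proof -
  have "2 * polar q (h x x) e = 0"
    by (metis add.right_inverse mult_2 polar_h_skew)
  then show ?thesis
    using two by simp
qed

section \<open>The special module on Z x Z and its skew form\<close>

abbreviation M where "M \<equiv> square_module t"

definition act :: "'k \<times> 'v \<times> 'k \<Rightarrow> 'z \<times> 'z \<Rightarrow> 'z \<times> 'z" where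
  "act = (\<lambda>(a, v, b) (x, y). (t a x + m y v, t b y + m x (\<sigma> v)))"

text \<open>On u (x,0) = (0,x) and (x',0) the middle entry has to be h(x,x'), and on (x',0), (x,0)
  the first entry has to be twice the cocycle g(x,x'). The remaining terms make the form skew and
  symmetric under exchanging the two idempotents.\<close>

definition \<beta> :: "'z \<times> 'z \<Rightarrow> 'z \<times> 'z \<Rightarrow> 'k \<times> 'v \<times> 'k" where
  "\<beta> = (\<lambda>(x, y) (x', y').
     (polar q (h x x') e, h y x' - h y' x, polar q (h y y') e))"

lemma M_simps [simp]:
  "carrier M = UNIV" "p \<oplus>\<^bsub>M\<^esub> p' = p + p'" "\<zero>\<^bsub>M\<^esub> = 0" "c \<odot>\<^bsub>M\<^esub> (x, y) = (t c x, t c y)"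
  by (simp_all add: square_module_def)

lemma act_simps [simp]: "act (a, v, b) (x, y) = (t a x + m y v, t b y + m x (\<sigma> v))"
  by (simp add: act_def)

lemma module_M: "Module.module K M"
proof (rule moduleI)
  show "abelian_group M"
    by (rule abelian_group_of_plus) (auto simp: square_module_def)
qed (auto simp: ring_of_type_algebra_simps Z.scale_left_distrib Z.scale_right_distrib)

lemma bilinear_act: "bilinear_on K J M M act"
  unfolding bilinear_on_def linear_on_def
  by (auto simp: sig_add sig_scale Z.scale_left_distrib Z.scale_right_distrib mult.commute)

lemma act_add: "act (j \<oplus>\<^bsub>J\<^esub> k) p = act j p + act k p" "act j (p + p') = act j p + act j p'"
  "act (j \<ominus>\<^bsub>J\<^esub> k) p = act j p - act k p"
proof -
  show "act (j \<oplus>\<^bsub>J\<^esub> k) p = act j p + act k p" for j k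
    by (cases j; cases k; cases p) (simp add: sig_add Z.scale_left_distrib)
  from this[of "j \<ominus>\<^bsub>J\<^esub> k" k] show "act (j \<ominus>\<^bsub>J\<^esub> k) p = act j p - act k p"
    by (cases j; cases k) simp
  show "act j (p + p') = act j p + act j p'"
    by (cases j; cases p; cases p') (simp add: Z.scale_right_distrib)
qed

text \<open>Doubling removes the halves of the spin product. What is not formal is the term coming
  from two vectors: it is \<open>sig_m_polar\<close> in the first coordinate and
  \<open>m_sig_polar\<close> in the second.\<close>

lemma act_jordan: "act (j \<otimes>\<^bsub>J\<^esub> k) p + act (j \<otimes>\<^bsub>J\<^esub> k) p = act j (act k p) + act k (act j p)"
proof (cases j; cases k; cases p)
  fix a v b c w d x y assume eqs: "j = (a, v, b)" "k = (c, w, d)" "p = (x, y)"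
  have half: "t (r / 2) z + t (r / 2) z = t r z" for r z
    using two by (simp flip: Z.scale_left_distrib)
  have *: "t (a * c + r / 2) z + t (a * c + r / 2) z = t a (t c z) + t c (t a z) + t r z" for a c r z
    using half[of r z] by (simp add: Z.scale_left_distrib algebra_simps)
  have regroup: "(P + (Q + R)) + (P + (Q + R)) = (P + P) + ((Q + Q) + (R + R))" for P Q R :: 'z
    by (simp only: add_ac)
  have "m (m x (\<sigma> w)) v + m (m x (\<sigma> v)) w = t (polar q v w) x"
    "m (m y w) (\<sigma> v) + m (m y v) (\<sigma> w) = t (polar q v w) y"
    using sig_m_polar[of x v w] m_sig_polar[of y v w] by (simp_all only: add_ac)
  note polar = this[symmetric]
  show ?thesis
    unfolding eqs spin_simps act_simps sig_add sig_scale m_linear plus_prod_def fst_conv snd_conv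
      regroup half * polar
    unfolding Z.scale_right_distrib Z.scale_left_distrib
    by (simp add: add_ac mult.commute)
qed

lemma double_cancel:
  assumes "p + p = p' + (p' :: 'z \<times> 'z)"
  shows "p = p'"
proof -
  have "t 2 (fst p) = t 2 (fst p')" "t 2 (snd p) = t 2 (snd p')"
    using assms Z.scale_left_distrib[of 1 1] by (cases p; cases p'; simp)+
  then show ?thesis
    using two by (cases p; cases p') simp
qed

text \<open>The usual computation for operators: twice the action of 2 j(jk) is j(jk + kj) + (jk +
  kj)j, twice that of (jj)k is jjk + kjj, and the difference is 2 jkj.\<close>

lemma act_U: "act (jordan_U J j k) p = act j (act k (act j p))"
proof (rule double_cancel)
  have sq: "act (j \<otimes>\<^bsub>J\<^esub> j) p = act j (act j p)" for p
    by (rule double_cancel) (rule act_jordan)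
  have "act (j \<otimes>\<^bsub>J\<^esub> (j \<otimes>\<^bsub>J\<^esub> k)) p + act (j \<otimes>\<^bsub>J\<^esub> (j \<otimes>\<^bsub>J\<^esub> k)) p +
      (act (j \<otimes>\<^bsub>J\<^esub> (j \<otimes>\<^bsub>J\<^esub> k)) p + act (j \<otimes>\<^bsub>J\<^esub> (j \<otimes>\<^bsub>J\<^esub> k)) p) =
      act j (act (j \<otimes>\<^bsub>J\<^esub> k) p + act (j \<otimes>\<^bsub>J\<^esub> k) p) +
      (act (j \<otimes>\<^bsub>J\<^esub> k) (act j p) + act (j \<otimes>\<^bsub>J\<^esub> k) (act j p))"
    unfolding act_jordan[of j "j \<otimes>\<^bsub>J\<^esub> k"] act_add by (simp only: add_ac)
  then show "act (jordan_U J j k) p + act (jordan_U J j k) p =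
      act j (act k (act j p)) + act j (act k (act j p))"
    using act_jordan[of "j \<otimes>\<^bsub>J\<^esub> j" k p]
    unfolding jordan_U_def act_add act_jordan[of j k] sq by (simp add: algebra_simps)
qed

lemma special_module_M: "special_module K J M act"
  unfolding special_module_def using module_M bilinear_act act_U by auto

lemma bilinear_\<beta>: "bilinear_on K M M J \<beta>"
  unfolding bilinear_on_def linear_on_def
  by (auto simp: \<beta>_def distrib_left scale_right_diff_distrib)

lemma \<beta>_skew: "\<beta> p p' = \<ominus>\<^bsub>J\<^esub> \<beta> p' p"
  using polar_h_skew[of "fst p" "fst p'"] polar_h_skew[of "snd p" "snd p'"]
  by (cases p; cases p') (simp add: \<beta>_def)

lemma M_input_quadrangular: "M_input K J spin_e0 spin_e1 (0, e, 0) M act \<beta>"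
  by (rule M_input_spin[OF special_module_M bilinear_\<beta> \<beta>_skew])

lemma special_module_0_M: "special_module_0 M act spin_e0 = range (\<lambda>x. (x, 0))"
  by (auto simp: special_module_0_def spin_e0_def)

section \<open>Type (d): E6, E7 and E8\<close>

lemma root_data_wf_exceptional: "root_data_wf (exceptional_type s q e m h)"
proof -
  have "group (grp13 (exceptional_type s q e m h))"
  proof (rule groupI)
    fix p assume "p \<in> carrier (grp13 (exceptional_type s q e m h))"
    obtain a c where p: "p = (a, c)" by fastforce
    \<comment> \<open>With \<open>polar_h_self\<close> the cocycle vanishes on a and -a, so (-a, -c)
      is the inverse of (a, c).\<close>
    have "h (- a) a = - h a a" "h a (- a) = - h a a"
      using h_linear(4)[where c="- 1" and x=a and y=a] h_linear(2)[where c="- 1" and x=a and y=a]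
      by simp_all
    then show "\<exists>p'\<in>carrier (grp13 (exceptional_type s q e m h)).
        p' \<otimes>\<^bsub>grp13 (exceptional_type s q e m h)\<^esub> p = \<one>\<^bsub>grp13 (exceptional_type s q e m h)\<^esub>"
      unfolding p by (intro bexI[of _ "(- a, - c)"]) (simp_all add: exceptional_type_def qa_g_def)
  qed (auto simp: exceptional_type_def qa_g_def add_divide_distrib)
  moreover have "group (grp24 (exceptional_type s q e m h))"
    by (auto simp: exceptional_type_def intro!: group_additive_group)
  ultimately show ?thesis
    by (auto simp: root_data_wf_def exceptional_type_def additive_group_def)
qed

lemma root_data_iso_exceptional:
  "root_data_iso (exceptional_type s q e m h)
     (construction_M K J spin_e0 spin_e1 (0, e, 0) M act \<beta>)"
    (is "root_data_iso ?D ?D'")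
proof -
  let ?f = "\<lambda>(x, c). ((x, 0), (c, 0, 0))" and ?g = "\<lambda>v. (0, v, 0)"
  show ?thesis
  proof (rule root_data_isoI[where f = ?f and g = ?g])
    show "root_data_wf ?D"
      by (rule root_data_wf_exceptional)
    show "?f \<in> iso (grp13 ?D) (grp13 ?D')"
      unfolding construction_M_def exceptional_type_def root_data.simps peirce_zero_spin
        special_module_0_M
      by (auto simp: iso_iff hom_def inj_on_def \<beta>_def qa_g_def half_ring_of_type_algebra[OF two] image_iff)
    show "?g \<in> iso (grp24 ?D) (grp24 ?D')"
      unfolding construction_M_def exceptional_type_def root_data.simps peirce_half_spin
      by (auto simp: iso_iff hom_def inj_on_def additive_group_def)
  next
    fix a a' assume "a \<in> carrier (grp13 ?D)" "a' \<in> carrier (grp13 ?D)"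
    show "?g (c13 ?D a a') = c13 ?D' (?f a) (?f a')"
      by (cases a; cases a') (simp add: construction_M_def exceptional_type_def \<beta>_def)
  next
    fix v w
    show "?f (c24 ?D v w) = c24 ?D' (?g v) (?g w)"
      using two by (simp add: construction_M_def exceptional_type_def spin_e0_def zero_prod_def)
  next
    fix a v
    \<comment> \<open>Here u (x,0) = (0,x) and v (0,x) = (x v, 0), so half of the form on these two
      vectors is h(x, x v)/2, which is \<theta>(x,v).\<close>
    show "?g (c14_2 ?D a v) = c14_2 ?D' (?f a) (?g v) \<and> ?f (c14_3 ?D a v) = c14_3 ?D' (?f a) (?g v)"
      using two
      by (cases a) (simp add: construction_M_def exceptional_type_def U_base_spin U_half_spin \<beta>_def
          qa_theta_def half_ring_of_type_algebra[OF two] scale_double)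
  qed (simp_all add: construction_M_def exceptional_type_def additive_group_def zero_prod_def)
qed

end

section \<open>Hermitian matrices\<close>

definition mat2 :: "'a \<Rightarrow> 'a \<Rightarrow> 'a \<Rightarrow> 'a \<Rightarrow> 'a^2^2" where
  "mat2 a b c d = (\<chi> i j. if i = 1 then (if j = 1 then a else b) else (if j = 1 then c else d))"

lemma mat2_nth [simp]:
  "mat2 a b c d $ 1 $ 1 = a" "mat2 a b c d $ 1 $ 2 = b"
  "mat2 a b c d $ 2 $ 1 = c" "mat2 a b c d $ 2 $ 2 = d"
  by (simp_all add: mat2_def)

lemma mat2_eta: "m = mat2 (m $ 1 $ 1) (m $ 1 $ 2) (m $ 2 $ 1) (m $ 2 $ 2)"
  by (simp add: vec_eq_iff forall_2)

lemma mat2_eq_iff [simp]: "mat2 a b c d = mat2 a' b' c' d' \<longleftrightarrow> a = a' \<and> b = b' \<and> c = c' \<and> d = d'"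
  by (auto simp: vec_eq_iff forall_2)

lemma mat2_simps [simp]:
  "mat2 a b c d + mat2 a' b' c' d' = mat2 (a + a') (b + b') (c + c') (d + d')"
  "mat2 e f g k ** mat2 e' f' g' k' =
     mat2 (e * e' + f * g') (e * f' + f * k') (g * e' + k * g') (g * f' + k * k')"
  "map_matrix \<phi> (mat2 x y z w) = mat2 (\<phi> x) (\<phi> y) (\<phi> z) (\<phi> w)"
  "transpose (mat2 x y z w) = mat2 x z y w"
  by (simp_all add: vec_eq_iff forall_2 matrix_matrix_mult_def sum_2 transpose_def)

lemma mat2_zero: "0 = mat2 0 0 0 0" and mat2_one: "mat 1 = mat2 1 0 0 1"
  and mat2_e0: "diag_e0 = mat2 1 0 0 0" and mat2_e1: "diag_e1 = mat2 0 0 0 1"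
  by (simp_all add: vec_eq_iff forall_2 mat_def diag_e0_def diag_e1_def)

lemma matrix_add_rdistrib: "(A + B) ** C = A ** C + B ** (C :: 'a::semiring_1^'n^'m)"
  by (simp add: vec_eq_iff matrix_matrix_mult_def distrib_right sum.distrib)

section \<open>Halving in a skew field\<close>

lemma two_central: "2 * x = x * (2 :: 'l::ring_1)"
  by (simp only: mult_2 mult_2_right)

text \<open>The inverse of a central element is central; this lets halves move across products
  although L is not commutative.\<close>

lemma inverse_2_central: "inverse 2 * x = x * inverse (2 :: 'l::division_ring)"
  by (rule mult_commute_imp_mult_inverse_commute) (rule two_central)

lemma half_mult_left: "x / 2 * y = x * y / (2 :: 'l::division_ring)"
  by (simp only: divide_inverse mult.assoc inverse_2_central[of y])

lemma half_mult: "1 / 2 * x = x / (2 :: 'l::division_ring)"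
  by (simp add: half_mult_left)

lemma half_add_half:
  assumes "(2 :: 'l::division_ring) \<noteq> 0"
  shows "x / 2 + x / 2 = (x :: 'l)"
proof -
  have "x / 2 + x / 2 = x * 2 * inverse 2"
    by (simp only: mult_2_right divide_inverse distrib_right)
  then show ?thesis
    by (simp only: mult.assoc right_inverse[OF assms] mult_1_right)
qed

section \<open>Skew fields with involution and their symmetric centre\<close>

locale skew_involution =
  fixes \<sigma> :: "'l::division_ring \<Rightarrow> 'l"
  assumes two: "(2::'l) \<noteq> 0" and involution: "involution \<sigma>"
begin

lemma sigma_simps [simp]: "\<sigma> (a + b) = \<sigma> a + \<sigma> b" "\<sigma> (a * b) = \<sigma> b * \<sigma> a" "\<sigma> (\<sigma> a) = a"
  using involution by (auto simp: involution_def)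

lemma sigma_zero [simp]: "\<sigma> 0 = 0"
  by (metis sigma_simps(1) add_cancel_right_left)

lemma sigma_one [simp]: "\<sigma> 1 = 1"
  by (metis sigma_simps(2,3) mult_1 mult_1_right)

lemma sigma_minus [simp]: "\<sigma> (- a) = - \<sigma> a"
  by (metis sigma_simps(1) sigma_zero eq_neg_iff_add_eq_0 add.left_inverse)

lemma sigma_diff [simp]: "\<sigma> (a - b) = \<sigma> a - \<sigma> b"
  by (simp only: diff_conv_add_uminus sigma_simps sigma_minus)

lemma sigma_eq_0_iff [simp]: "\<sigma> a = 0 \<longleftrightarrow> a = 0"
  by (metis sigma_simps(3) sigma_zero)

lemma sigma_inverse [simp]: "\<sigma> (inverse a) = inverse (\<sigma> a)"
proof (cases "a = 0")
  case False
  then have "\<sigma> (inverse a) * \<sigma> a = 1"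
    by (simp flip: sigma_simps(2))
  then show ?thesis
    by (metis inverse_unique inverse_inverse_eq)
qed simp

lemma sigma_two [simp]: "\<sigma> 2 = 2"
  using sigma_simps(1)[of 1 1] by simp

lemma sigma_half [simp]: "\<sigma> (a / 2) = \<sigma> a / 2"
  by (simp only: divide_inverse sigma_simps sigma_inverse sigma_two inverse_2_central)

text \<open>The centre of \<open>L\<close> need not be fixed by \<open>\<sigma>\<close>, so the base field consists of its symmetric elements.\<close>

definition K :: "'l ring" where
  "K = \<lparr>carrier = {c. \<sigma> c = c \<and> (\<forall>x. c * x = x * c)}, monoid.mult = (*), one = 1, zero = 0, add = (+)\<rparr>"

lemma K_simps [simp]:
  "c \<in> carrier K \<longleftrightarrow> \<sigma> c = c \<and> (\<forall>x. c * x = x * c)"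
  "x \<otimes>\<^bsub>K\<^esub> y = x * y" "\<one>\<^bsub>K\<^esub> = 1" "\<zero>\<^bsub>K\<^esub> = 0" "x \<oplus>\<^bsub>K\<^esub> y = x + y"
  by (simp_all add: K_def)

lemma cring_K: "cring K"
proof (rule cringI)
  show "abelian_group K"
  proof (rule abelian_groupI)
    fix x assume "x \<in> carrier K"
    then show "\<exists>y\<in>carrier K. y \<oplus>\<^bsub>K\<^esub> x = \<zero>\<^bsub>K\<^esub>"
      by (intro bexI[of _ "- x"]) auto
  qed (auto simp: distrib_left distrib_right add_ac)
  have central: "a * b * x = x * (a * b)" if a: "\<forall>x. a * x = x * a" and b: "\<forall>x. b * x = x * b" for a b x :: 'l
  proof -
    have "a * b * x = a * (x * b)"
      using b by (simp only: mult.assoc)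
    also have "\<dots> = a * x * b"
      by (simp only: mult.assoc)
    also have "\<dots> = x * (a * b)"
      by (simp only: a[rule_format, of x] mult.assoc)
    finally show ?thesis .
  qed
  show "comm_monoid K"
  proof (rule comm_monoidI)
    fix x y assume "x \<in> carrier K" "y \<in> carrier K"
    \<comment> \<open>As \<sigma> reverses products, the product of two symmetric elements is again
      symmetric only because they commute.\<close>
    then show "x \<otimes>\<^bsub>K\<^esub> y \<in> carrier K" "x \<otimes>\<^bsub>K\<^esub> y = y \<otimes>\<^bsub>K\<^esub> x"
      using central[of x y] unfolding K_simps sigma_simps by metis+
  qed (simp_all (no_asm) add: mult.assoc)
qed (simp (no_asm) add: distrib_right)

lemma field_K: "field K"
proof (rule cring.cring_fieldI2[OF cring_K])
  fix a assume a: "a \<in> carrier K" "a \<noteq> \<zero>\<^bsub>K\<^esub>"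
  then show "\<exists>b\<in>carrier K. a \<otimes>\<^bsub>K\<^esub> b = \<one>\<^bsub>K\<^esub>"
    by (intro bexI[of _ "inverse a"]) (auto simp: mult_commute_imp_mult_inverse_commute)
qed simp

lemma field_char_not_2_K: "field_char_not_2 K"
  using field_K two by (simp add: field_char_not_2_def)

lemma half_K: "half K = 1 / 2"
  by (rule half_eq[OF field_K])
    (use two half_add_half[OF two, of 1] in \<open>auto simp: half_mult distrib_left intro: two_central\<close>)

section \<open>The Jordan algebra of hermitian matrices\<close>

abbreviation J where "J \<equiv> hermitian_matrices \<sigma>"
abbreviation hf :: "'l^2^2 \<Rightarrow> 'l^2^2" where "hf \<equiv> map_matrix (\<lambda>l. l / 2)"

lemma J_simps [simp]:
  "m \<otimes>\<^bsub>J\<^esub> n = hf (m ** n + n ** m)" "\<one>\<^bsub>J\<^esub> = mat 1" "\<zero>\<^bsub>J\<^esub> = 0" "m \<oplus>\<^bsub>J\<^esub> n = m + n"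
  "c \<odot>\<^bsub>J\<^esub> m = map_matrix (\<lambda>l. c * l) m"
  by (simp_all add: hermitian_matrices_def)

lemma carrier_J: "m \<in> carrier J \<longleftrightarrow> transpose (map_matrix \<sigma> m) = m"
  by (simp add: hermitian_matrices_def)

lemma mat2_in_J [simp]: "mat2 a b c d \<in> carrier J \<longleftrightarrow> \<sigma> a = a \<and> \<sigma> c = b \<and> \<sigma> d = d"
  by (auto simp: carrier_J)

lemma carrier_J_cases:
  assumes "m \<in> carrier J"
  obtains a l b where "m = mat2 a (\<sigma> l) l b" "\<sigma> a = a" "\<sigma> b = b"
  using assms by (subst (asm) mat2_eta) (metis mat2_eta mat2_in_J)

text \<open>With these rules \<open>hf\<close> leaves every product, and Jordan identities become
  identities of associative matrix words.\<close>

lemma hf_add: "hf (A + B) = hf A + hf B"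
  and hf_mult: "hf A ** B = hf (A ** B)" "A ** hf B = hf (A ** B)"
  and hf_double: "hf A + hf A = A"
  by (simp_all add: vec_eq_iff forall_2 matrix_matrix_mult_def sum_2 add_divide_distrib half_mult_left
      half_add_half[OF two])

lemma module_J: "Module.module K J"
proof (rule moduleI)
  show "abelian_group J"
  proof (rule abelian_group_of_plus)
    show "- x \<in> carrier J" if "x \<in> carrier J" for x
      using that by (auto simp: carrier_J vec_eq_iff transpose_def)
  qed (auto simp: hermitian_matrices_def vec_eq_iff transpose_def)
next
  fix a x assume "a \<in> carrier K" "x \<in> carrier J"
  then show "a \<odot>\<^bsub>J\<^esub> x \<in> carrier J"
    by (auto elim!: carrier_J_cases)
qed (simp_all (no_asm) add: cring_K vec_eq_iff distrib_left distrib_right mult.assoc)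

text \<open>The subtraction of the record is pinned down only on the carrier, while the minus of
  matrices is total; hence the membership conditions.\<close>

lemma a_minus_J [simp]:
  assumes "m \<in> carrier J" "n \<in> carrier J"
  shows "m \<ominus>\<^bsub>J\<^esub> n = m - n"
proof -
  interpret Module.module K J by (rule module_J)
  have "- n \<in> carrier J"
    using assms(2) by (auto simp: carrier_J vec_eq_iff transpose_def)
  then have "\<ominus>\<^bsub>J\<^esub> n = - n"
    using assms(2) by (intro M.minus_equality) auto
  then show ?thesis
    by (simp add: a_minus_def)
qed

lemma J_mult_closed:
  assumes "m \<in> carrier J" "n \<in> carrier J"
  shows "m \<otimes>\<^bsub>J\<^esub> n \<in> carrier J"
  using assms by (auto elim!: carrier_J_cases simp: add_ac)

lemma J_add_closed:
  assumes "m \<in> carrier J" "n \<in> carrier J"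
  shows "m + n \<in> carrier J"
  using assms by (auto elim!: carrier_J_cases)

lemma J_mult_add: "m \<otimes>\<^bsub>J\<^esub> (n + n') = m \<otimes>\<^bsub>J\<^esub> n + m \<otimes>\<^bsub>J\<^esub> n'"
  "(m + m') \<otimes>\<^bsub>J\<^esub> n = m \<otimes>\<^bsub>J\<^esub> n + m' \<otimes>\<^bsub>J\<^esub> n"
  by (simp_all add: hf_add matrix_add_ldistrib matrix_add_rdistrib add_ac)

lemma J_mult_smult:
  assumes "c \<in> carrier K"
  shows "m \<otimes>\<^bsub>J\<^esub> (c \<odot>\<^bsub>J\<^esub> n) = c \<odot>\<^bsub>J\<^esub> (m \<otimes>\<^bsub>J\<^esub> n)" "(c \<odot>\<^bsub>J\<^esub> m) \<otimes>\<^bsub>J\<^esub> n = c \<odot>\<^bsub>J\<^esub> (m \<otimes>\<^bsub>J\<^esub> n)"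
proof -
  have *: "a * (c * b) = c * (a * b)" for a b
  proof -
    have "a * (c * b) = (c * a) * b"
      using assms by (simp only: K_simps mult.assoc)
    then show ?thesis
      by (simp only: mult.assoc)
  qed
  show "m \<otimes>\<^bsub>J\<^esub> (c \<odot>\<^bsub>J\<^esub> n) = c \<odot>\<^bsub>J\<^esub> (m \<otimes>\<^bsub>J\<^esub> n)"
    "(c \<odot>\<^bsub>J\<^esub> m) \<otimes>\<^bsub>J\<^esub> n = c \<odot>\<^bsub>J\<^esub> (m \<otimes>\<^bsub>J\<^esub> n)"
    by (simp_all add: vec_eq_iff forall_2 matrix_matrix_mult_def sum_2 distrib_left mult.assoc * add_divide_distrib
        times_divide_eq_right[symmetric] del: times_divide_eq_right)
qed

lemma bilinear_J: "bilinear_on K J J J (monoid.mult J)"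
  unfolding bilinear_on_def linear_on_def
  by (simp add: Pi_iff J_mult_closed J_mult_add J_mult_smult del: J_simps(1) J_simps(5) K_simps(1))

text \<open>The nested product is (xxy + 2 xyx + yxx)/4. Twice this minus (xxy + yxx)/2 leaves the
  word xyx.\<close>

lemma jordan_U_J:
  assumes "x \<in> carrier J" "y \<in> carrier J"
  shows "jordan_U J x y = x ** y ** x"
proof -
  have "jordan_U J x y = (x \<otimes>\<^bsub>J\<^esub> (x \<otimes>\<^bsub>J\<^esub> y) + x \<otimes>\<^bsub>J\<^esub> (x \<otimes>\<^bsub>J\<^esub> y)) - (x \<otimes>\<^bsub>J\<^esub> x) \<otimes>\<^bsub>J\<^esub> y"
    unfolding jordan_U_def using assms module_J
    by (subst a_minus_J) (auto intro!: J_mult_closed J_add_closed simp del: J_simps(1))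
  also have "x \<otimes>\<^bsub>J\<^esub> (x \<otimes>\<^bsub>J\<^esub> y) = hf (hf (x ** x ** y + x ** y ** x + (x ** y ** x + y ** x ** x)))"
    by (simp add: hf_mult hf_add matrix_add_ldistrib matrix_add_rdistrib matrix_mul_assoc)
  also have "(x \<otimes>\<^bsub>J\<^esub> x) \<otimes>\<^bsub>J\<^esub> y = hf (x ** x ** y + y ** x ** x)"
    by (simp add: hf_add hf_double matrix_mul_assoc)
  finally show ?thesis
    by (simp only: hf_double) (simp add: hf_add hf_double)
qed

text \<open>Because the Jordan square is the matrix square, each side is a quarter of the sum of the
  four words with three letters x and one y.\<close>

lemma jordan_identity_J:
  "((x \<otimes>\<^bsub>J\<^esub> x) \<otimes>\<^bsub>J\<^esub> y) \<otimes>\<^bsub>J\<^esub> x = (x \<otimes>\<^bsub>J\<^esub> x) \<otimes>\<^bsub>J\<^esub> (y \<otimes>\<^bsub>J\<^esub> x)"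
proof -
  have "x \<otimes>\<^bsub>J\<^esub> x = x ** x"
    by (simp add: hf_add hf_double)
  then show ?thesis
    by (simp add: hf_mult hf_add matrix_add_ldistrib matrix_add_rdistrib matrix_mul_assoc add_ac)
qed

lemma jordan_algebra_J: "jordan_algebra K J"
proof -
  have "hf (m + m) = m" for m
    by (simp add: hf_add hf_double)
  moreover have "\<one>\<^bsub>J\<^esub> \<in> carrier J"
    by (simp add: mat2_one)
  ultimately show ?thesis
    unfolding jordan_algebra_def using field_char_not_2_K module_J bilinear_J jordan_identity_J
    by (simp add: add.commute)
qed

text \<open>The diagonals of x e_0 x and x e_1 x contain the squares of the diagonal entries of x
  and the product of l with its conjugate. In a skew field their vanishing makes every entry
  zero.\<close>

lemma nondegenerate_J: "jordan_nondegenerate J"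
  unfolding jordan_nondegenerate_def
proof safe
  fix x assume x: "x \<in> carrier J" and *: "\<forall>y\<in>carrier J. jordan_U J x y = \<zero>\<^bsub>J\<^esub>"
  have "x ** mat2 1 0 0 0 ** x = 0" "x ** mat2 0 0 0 1 ** x = 0"
    using *[rule_format, of "mat2 1 0 0 0"] *[rule_format, of "mat2 0 0 0 1"] by (simp_all add: jordan_U_J[OF x])
  then show "x = \<zero>\<^bsub>J\<^esub>"
    using x by (auto elim!: carrier_J_cases simp: mat2_zero)
qed

lemma idempotents_J: "supplementary_proper_idempotents J diag_e0 diag_e1"
  using two half_add_half[OF two, of 1]
  by (simp add: supplementary_proper_idempotents_def mat2_e0 mat2_e1 mat2_one mat2_zero add_divide_distrib)

text \<open>Placing l in the lower left corner gives the order of factors in the relations: the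
  upper left entry of \<open>offdiag v ** offdiag w\<close> is \<open>\<sigma> v * w\<close>, and a
  row (0, x) times \<open>offdiag l\<close> is (x l, 0).\<close>

definition offdiag :: "'l \<Rightarrow> 'l^2^2" where "offdiag l = mat2 0 (\<sigma> l) l 0"
definition corner :: "'l \<Rightarrow> 'l^2^2" where "corner a = mat2 a 0 0 0"

text \<open>Separates the Peirce eigenvalues 1/2 and 1, removing the lower right entry from
  J_{1/2}.\<close>

lemma half_eq_self_iff: "a / 2 = a \<longleftrightarrow> a = (0::'l)"
  using half_add_half[OF two, of a] by auto

lemma peirce_half_J: "peirce J diag_e1 (half K) = range offdiag"
proof safe
  fix x assume "x \<in> peirce J diag_e1 (half K)"
  then have x: "x \<in> carrier J" and eq: "diag_e1 \<otimes>\<^bsub>J\<^esub> x = (1 / 2) \<odot>\<^bsub>J\<^esub> x"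
    by (auto simp: peirce_def half_K)
  obtain a l b where *: "x = mat2 a (\<sigma> l) l b"
    using x by (auto elim: carrier_J_cases)
  have "diag_e1 \<otimes>\<^bsub>J\<^esub> x = mat2 0 (\<sigma> l / 2) (l / 2) b"
    by (simp add: * mat2_e1 add_divide_distrib half_add_half[OF two])
  moreover have "(1 / 2) \<odot>\<^bsub>J\<^esub> x = mat2 (a / 2) (\<sigma> l / 2) (l / 2) (b / 2)"
    by (simp add: * half_mult)
  ultimately have "a / 2 = 0" "b / 2 = b"
    using eq by (simp_all only: mat2_eq_iff)
  then have "a = 0" "b = 0"
    using two half_eq_self_iff[of b] half_add_half[OF two, of a] by simp_all
  then show "x \<in> range offdiag"
    by (simp add: * offdiag_def)
next
  fix l show "offdiag l \<in> peirce J diag_e1 (half K)"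
    by (auto simp: peirce_def half_K offdiag_def mat2_e1 half_mult)
qed

lemma peirce_zero_J: "peirce J diag_e1 \<zero>\<^bsub>K\<^esub> = corner ` fixed_elements \<sigma>"
proof safe
  fix x assume "x \<in> peirce J diag_e1 \<zero>\<^bsub>K\<^esub>"
  then have x: "x \<in> carrier J" and eq: "diag_e1 \<otimes>\<^bsub>J\<^esub> x = 0 \<odot>\<^bsub>J\<^esub> x"
    by (auto simp: peirce_def)
  obtain a l b where *: "x = mat2 a (\<sigma> l) l b" "\<sigma> a = a"
    using x by (auto elim: carrier_J_cases)
  with eq half_add_half[OF two, of b] half_add_half[OF two, of l] have "x = corner a"
    using two by (auto simp: mat2_e1 corner_def add_divide_distrib)
  then show "x \<in> corner ` fixed_elements \<sigma>"
    using * by (intro image_eqI) (simp_all add: fixed_elements_def)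
next
  fix a assume "a \<in> fixed_elements \<sigma>"
  then show "corner a \<in> peirce J diag_e1 \<zero>\<^bsub>K\<^esub>"
    by (auto simp: peirce_def corner_def fixed_elements_def mat2_e1)
qed

lemma invertible_J:
  assumes "l \<noteq> 0"
  shows "jordan_invertible J (offdiag l)"
proof -
  have cancel: "inverse a * (a * x) = x" "a * (inverse a * x) = x" if "a \<noteq> 0" for a x :: 'l
    using that by (simp_all flip: mult.assoc)
  show ?thesis
    using assms two unfolding jordan_invertible_def
    \<comment> \<open>This witness is the ordinary matrix inverse of
      \<open>offdiag l\<close>.\<close>
    by (intro bexI[of _ "offdiag (inverse (\<sigma> l))"])
      (simp_all add: offdiag_def mat2_one add_divide_distrib mult.assoc cancel half_add_half[OF two])
qed

lemma M_input_J:
  assumes "special_module K J M act" "bilinear_on K M M J \<beta>"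
    "\<And>x y. \<lbrakk>x \<in> carrier M; y \<in> carrier M\<rbrakk> \<Longrightarrow> \<beta> x y = \<ominus>\<^bsub>J\<^esub> \<beta> y x"
  shows "M_input K J diag_e0 diag_e1 (offdiag 1) M act \<beta>"
proof -
  have "\<forall>v\<in>range offdiag. v \<noteq> \<zero>\<^bsub>J\<^esub> \<longrightarrow> jordan_invertible J v"
    using invertible_J by (auto simp: offdiag_def mat2_zero)
  moreover have "offdiag 1 \<otimes>\<^bsub>J\<^esub> offdiag 1 = \<one>\<^bsub>J\<^esub>"
    using two half_add_half[OF two, of 1] by (simp add: offdiag_def mat2_one add_divide_distrib)
  ultimately show ?thesis
    unfolding M_input_def peirce_half_J
    using assms jordan_algebra_J nondegenerate_J idempotents_J by blast
qed

lemma offdiag_in_J: "offdiag l \<in> carrier J"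
  by (simp add: offdiag_def)

lemma corner_in_J: "a \<in> fixed_elements \<sigma> \<Longrightarrow> corner a \<in> carrier J"
  by (simp add: corner_def fixed_elements_def)

lemma U_base_J:
  assumes "a \<in> fixed_elements \<sigma>"
  shows "jordan_U J (offdiag 1) (corner a) = mat2 0 0 0 a"
  using jordan_U_J[OF offdiag_in_J[of 1] corner_in_J[OF assms]] by (simp add: offdiag_def corner_def)

lemma U_offdiag_J:
  assumes "a \<in> fixed_elements \<sigma>"
  shows "jordan_U J (offdiag l) (mat2 0 0 0 a) = corner (\<sigma> l * a * l)"
proof -
  have "mat2 0 0 0 a \<in> carrier J"
    using assms by (simp add: fixed_elements_def)
  from jordan_U_J[OF offdiag_in_J this] show ?thesis
    by (simp add: offdiag_def corner_def)
qed

lemma fixed_elements_closed: "0 \<in> fixed_elements \<sigma>"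
  "\<lbrakk>a \<in> fixed_elements \<sigma>; b \<in> fixed_elements \<sigma>\<rbrakk> \<Longrightarrow> a + b \<in> fixed_elements \<sigma>"
  "a \<in> fixed_elements \<sigma> \<Longrightarrow> - a \<in> fixed_elements \<sigma>"
  "a \<in> fixed_elements \<sigma> \<Longrightarrow> \<sigma> l * a * l \<in> fixed_elements \<sigma>"
  "\<sigma> l * l' + \<sigma> l' * l \<in> fixed_elements \<sigma>"
  by (auto simp: fixed_elements_def mult.assoc add.commute)

section \<open>Type (b): involutions\<close>

lemma M_input_involutory:
  "M_input K J diag_e0 diag_e1 (offdiag 1) zero_module (\<lambda>_ _. ()) (\<lambda>_ _. \<zero>\<^bsub>J\<^esub>)"
proof (rule M_input_J[OF special_module_zero_module[OF cring_K] bilinear_on_zero_module[OF module_J]])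
  interpret Module.module K J by (rule module_J)
  show "\<zero>\<^bsub>J\<^esub> = \<ominus>\<^bsub>J\<^esub> \<zero>\<^bsub>J\<^esub>"
    by (rule M.minus_equality[symmetric]) (simp_all add: mat2_zero)
qed

text \<open>The Jordan product of two off-diagonal matrices is diagonal; multiplying by e_0 keeps
  the upper left entry and doubling cancels its half.\<close>

lemma c24_J: "(offdiag v \<otimes>\<^bsub>J\<^esub> offdiag w) \<otimes>\<^bsub>J\<^esub> diag_e0 + (offdiag v \<otimes>\<^bsub>J\<^esub> offdiag w) \<otimes>\<^bsub>J\<^esub> diag_e0 =
    corner (\<sigma> v * w + \<sigma> w * v)"
proof -
  have "mat2 p 0 0 p' \<otimes>\<^bsub>J\<^esub> diag_e0 = corner p" for p p'
    by (simp add: mat2_e0 corner_def add_divide_distrib half_add_half[OF two])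
  moreover have "offdiag v \<otimes>\<^bsub>J\<^esub> offdiag w =
      mat2 ((\<sigma> v * w + \<sigma> w * v) / 2) 0 0 ((v * \<sigma> w + w * \<sigma> v) / 2)"
    by (simp add: offdiag_def)
  ultimately show ?thesis
    by (simp add: corner_def half_add_half[OF two] del: J_simps(1))
qed

text \<open>The upper right entry comes out as \<open>\<sigma> l * a\<close>, which equals
  \<open>\<sigma> (a * l)\<close> because a is symmetric.\<close>

lemma c14_2_J: "mat2 0 0 0 a \<otimes>\<^bsub>J\<^esub> offdiag l + mat2 0 0 0 a \<otimes>\<^bsub>J\<^esub> offdiag l = offdiag (a * l)"
  if "a \<in> fixed_elements \<sigma>"
  using half_add_half[OF two] that
  by (simp add: offdiag_def fixed_elements_def)

lemma root_data_iso_involutory: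
  "root_data_iso (involutory_type \<sigma>)
     (construction_M K J diag_e0 diag_e1 (offdiag 1) zero_module (\<lambda>_ _. ()) (\<lambda>_ _. \<zero>\<^bsub>J\<^esub>))"
    (is "root_data_iso ?D ?D'")
proof -
  let ?f = "\<lambda>a. ((), corner a)"
  show ?thesis
  proof (rule root_data_isoI[where f = ?f and g = offdiag])
    show "root_data_wf ?D"
      using fixed_elements_closed
      by (auto simp: root_data_wf_def involutory_type_def intro!: group_additive_group)
        (simp_all add: additive_group_def)
    show "?f \<in> iso (grp13 ?D) (grp13 ?D')"
      unfolding construction_M_def involutory_type_def root_data.simps peirce_zero_J
        special_module_0_zero_module
      by (auto simp: iso_iff hom_def inj_on_def additive_group_def corner_def mat2_zero)
    show "offdiag \<in> iso (grp24 ?D) (grp24 ?D')"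
      unfolding construction_M_def involutory_type_def root_data.simps peirce_half_J
      by (auto simp: iso_iff hom_def inj_on_def additive_group_def offdiag_def)
  next
    fix v w
    show "?f (c24 ?D v w) = c24 ?D' (offdiag v) (offdiag w)"
      using c24_J by (simp add: construction_M_def involutory_type_def del: J_simps(1))
  next
    fix a l assume "a \<in> carrier (grp13 ?D)"
    then have "a \<in> fixed_elements \<sigma>"
      by (simp add: involutory_type_def additive_group_def)
    then show "offdiag (c14_2 ?D a l) = c14_2 ?D' (?f a) (offdiag l) \<and>
        ?f (c14_3 ?D a l) = c14_3 ?D' (?f a) (offdiag l)"
      using c14_2_J
      by (simp add: construction_M_def involutory_type_def U_base_J U_offdiag_J mat2_zero del: J_simps(1))
  qed (simp_all add: construction_M_def involutory_type_def additive_group_def corner_def offdiag_def mat2_zero)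
qed

end
section \<open>Pseudo-quadratic forms\<close>

definition vec2 :: "'a \<Rightarrow> 'a \<Rightarrow> 'a^2" where
  "vec2 x y = (\<chi> i. if i = 1 then x else y)"

lemma vec2_nth [simp]: "vec2 x y $ 1 = x" "vec2 x y $ 2 = y"
  by (simp_all add: vec2_def)

lemma vec2_eta: "x = vec2 (x $ 1) (x $ 2)"
  by (simp add: vec_eq_iff forall_2)

lemma vec2_cases [cases type]:
  obtains a b where "x = vec2 a b"
  using vec2_eta by blast

lemma vec2_simps [simp]: "vec2 x y = vec2 x' y' \<longleftrightarrow> x = x' \<and> y = y'"
  "vec2 a b + vec2 a' b' = vec2 (a + a') (b + b')"
  by (auto simp: vec_eq_iff forall_2)

lemma vec2_zero: "0 = vec2 0 0"
  by (simp add: vec_eq_iff forall_2)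

locale pseudo_quadratic = skew_involution \<sigma>
  for \<sigma> :: "'l::division_ring \<Rightarrow> 'l" +
  fixes r :: "'y::ab_group_add \<Rightarrow> 'l \<Rightarrow> 'y" and h :: "'y \<Rightarrow> 'y \<Rightarrow> 'l"
  assumes right_vector_space: "right_vector_space r" and skew_hermitian: "skew_hermitian_form \<sigma> r h"
begin

lemma r_simps [simp]: "r (x + y) a = r x a + r y a" "r x (a + b) = r x a + r x b" "r x 1 = x"
  and r_mult: "r x (a * b) = r (r x a) b"
  using right_vector_space by (auto simp: right_vector_space_def)

lemma r_zero [simp]: "r 0 a = 0" "r x 0 = 0"
  using r_simps(1)[of 0 0 a] r_simps(2)[of x 0 0] by simp_all

lemma h_simps [simp]: "h (x + y) z = h x z + h y z" "h x (y + z) = h x y + h x z"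
  "h x (r y a) = h x y * a" "\<sigma> (h x y) = - h y x"
  using skew_hermitian by (auto simp: skew_hermitian_form_def)

lemma h_zero [simp]: "h 0 x = 0" "h x 0 = 0"
  using h_simps(1)[of 0 0 x] h_simps(2)[of x 0 0] by simp_all

lemma h_minus [simp]: "h (- x) y = - h x y" "h x (- y) = - h x y"
  using h_simps(1)[of x "- x" y] h_simps(2)[of x y "- y"] by (simp_all add: eq_neg_iff_add_eq_0 add.commute)

lemma h_scale_left: "h (r x a) y = \<sigma> a * h x y"
proof -
  have "- h (r x a) y = \<sigma> (h y (r x a))"
    by (simp only: h_simps(4))
  also have "\<dots> = \<sigma> a * - h x y"
    by (simp only: h_simps(3,4) sigma_simps(2))
  finally show ?thesis
    by simp
qed

section \<open>Row vectors as a special module and their skew form\<close>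

abbreviation M where "M \<equiv> row_module r"
abbreviation act where "act \<equiv> row_action r"

text \<open>The matrix of values of h, made skew in (x, y). It is hermitian because \<sigma>
  exchanges the arguments of h up to sign. On (0,a) and (b,0) its lower left entry is h(a,b), and on
  (b,0) and (a,0) its upper left entry is h(b,a) - h(a,b), twice the cocycle.\<close>

definition \<beta> :: "'y^2 \<Rightarrow> 'y^2 \<Rightarrow> 'l^2^2" where
  "\<beta> x y = (\<chi> i j. h (x $ i) (y $ j) - h (y $ i) (x $ j))"

lemma \<beta>_vec2 [simp]: "\<beta> (vec2 a b) (vec2 c d) =
  mat2 (h a c - h c a) (h a d - h c b) (h b c - h d a) (h b d - h d b)"
  by (simp add: \<beta>_def vec_eq_iff forall_2)

lemma M_simps [simp]:
  "carrier M = UNIV" "x \<oplus>\<^bsub>M\<^esub> y = x + y" "\<zero>\<^bsub>M\<^esub> = 0" "c \<odot>\<^bsub>M\<^esub> vec2 a b = vec2 (r a c) (r b c)"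
  by (simp_all add: row_module_def vec_eq_iff forall_2)

lemma act_vec2 [simp]: "act (mat2 a b c d) (vec2 x y) = vec2 (r x a + r y c) (r x b + r y d)"
  by (simp add: row_action_def vec_eq_iff forall_2 sum_2)

text \<open>The right action reverses products. This does no harm to the U-operator, since the word
  j j' j is a palindrome.\<close>

lemma act_mult: "act (A ** B) x = act B (act A x)"
proof (cases x)
  fix a b assume "x = vec2 a b"
  then show ?thesis
    by (subst (1 2) mat2_eta[of A], subst (1 2) mat2_eta[of B]) (simp add: r_mult add_ac)
qed

lemma module_M: "Module.module K M"
proof (rule moduleI)
  show "abelian_group M"
    by (rule abelian_group_of_plus) (simp_all add: row_module_def)
next
  fix a b x assume ab: "a \<in> carrier K" "b \<in> carrier K"
  \<comment> \<open>Scalars act from the right, so the left module law needs them to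
    commute.\<close>
  then have "a * b = b * a"
    unfolding K_simps by blast
  then show "(a \<otimes>\<^bsub>K\<^esub> b) \<odot>\<^bsub>M\<^esub> x = a \<odot>\<^bsub>M\<^esub> (b \<odot>\<^bsub>M\<^esub> x)"
    by (cases x) (simp flip: r_mult)
qed (simp_all (no_asm) add: cring_K row_module_def vec_eq_iff)

lemma bilinear_act: "bilinear_on K J M M act"
proof -
  have add: "act j (x + y) = act j x + act j y" "act (j + k) x = act j x + act k x" for j k x y
    by (simp_all add: row_action_def vec_eq_iff forall_2 sum_2 add_ac)
  have smult: "act j (c \<odot>\<^bsub>M\<^esub> x) = c \<odot>\<^bsub>M\<^esub> act j x" "act (c \<odot>\<^bsub>J\<^esub> j) x = c \<odot>\<^bsub>M\<^esub> act j x"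
    if c: "c \<in> carrier K" for c j x
  proof -
    have "c * d = d * c" for d
      using c unfolding K_simps by blast
    \<comment> \<open>Scalars multiply matrices from the left and rows from the right; centrality
      reconciles the two sides.\<close>
    then have comm: "r (r y c) d = r (r y d) c" "r y (c * d) = r (r y d) c" for y d
      by (metis r_mult)+
    show "act j (c \<odot>\<^bsub>M\<^esub> x) = c \<odot>\<^bsub>M\<^esub> act j x" "act (c \<odot>\<^bsub>J\<^esub> j) x = c \<odot>\<^bsub>M\<^esub> act j x"
      by (simp_all add: row_action_def row_module_def vec_eq_iff sum_2 comm)
  qed
  show ?thesis
    unfolding bilinear_on_def linear_on_def
    by (simp add: add smult del: J_simps(5) K_simps(1))
qed

lemma special_module_M: "special_module K J M act"
  unfolding special_module_def
proof (intro conjI ballI)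
  show "act \<one>\<^bsub>J\<^esub> x = x" for x
    by (cases x) (simp add: mat2_one)
  show "act (jordan_U J j j') x = act j (act j' (act j x))"
    if "j \<in> carrier J" "j' \<in> carrier J" for j j' x
    using that by (simp add: jordan_U_J act_mult)
qed (rule module_M, rule bilinear_act)

lemma \<beta>_in_J: "\<beta> x y \<in> carrier J"
  by (cases x; cases y) simp

lemma bilinear_\<beta>: "bilinear_on K M M J \<beta>"
proof -
  have add: "\<beta> x (y + y') = \<beta> x y + \<beta> x y'" "\<beta> (x + x') y = \<beta> x y + \<beta> x' y" for x x' y y'
    by (simp_all add: \<beta>_def vec_eq_iff)
  have smult: "\<beta> x (c \<odot>\<^bsub>M\<^esub> y) = c \<odot>\<^bsub>J\<^esub> \<beta> x y" "\<beta> (c \<odot>\<^bsub>M\<^esub> x) y = c \<odot>\<^bsub>J\<^esub> \<beta> x y"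
    if c: "c \<in> carrier K" for c x y
  proof -
    have "\<sigma> c = c" "c * d = d * c" for d
      using c unfolding K_simps by blast+
    \<comment> \<open>A scalar leaves the first argument of h conjugated by \<sigma> and leaves the
      second on the right. Bilinearity over K thus rests on K being both symmetric and
      central.\<close>
    then have comm: "h x (r y c) = c * h x y" "h (r x c) y = c * h x y" for x y
      by (metis h_simps(3) h_scale_left)+
    show "\<beta> x (c \<odot>\<^bsub>M\<^esub> y) = c \<odot>\<^bsub>J\<^esub> \<beta> x y" "\<beta> (c \<odot>\<^bsub>M\<^esub> x) y = c \<odot>\<^bsub>J\<^esub> \<beta> x y"
      by (simp_all add: \<beta>_def row_module_def vec_eq_iff comm right_diff_distrib del: h_simps(3))
  qed
  show ?thesis
    unfolding bilinear_on_def linear_on_def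
    by (simp add: add smult \<beta>_in_J del: J_simps(5) K_simps(1))
qed

lemma \<beta>_skew: "\<beta> x y = \<ominus>\<^bsub>J\<^esub> \<beta> y x"
proof -
  interpret Module.module K J by (rule module_J)
  have "\<beta> x y + \<beta> y x = 0"
    by (simp add: \<beta>_def vec_eq_iff)
  then show ?thesis
    using \<beta>_in_J by (intro M.minus_equality[symmetric]) simp_all
qed

lemma M_input_pseudo_quadratic: "M_input K J diag_e0 diag_e1 (offdiag 1) M act \<beta>"
  by (rule M_input_J[OF special_module_M bilinear_\<beta> \<beta>_skew])

lemma special_module_0_M: "special_module_0 M act diag_e0 = range (\<lambda>x. vec2 x 0)"
proof -
  have "act diag_e0 x = x \<longleftrightarrow> x \<in> range (\<lambda>x. vec2 x 0)" for x
    by (cases x) (auto simp: mat2_e0)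
  then show ?thesis
    by (auto simp: special_module_0_def)
qed

text \<open>Conjugation exchanges the two terms along with their signs, so the cocycle has symmetric
  values.\<close>

lemma half_diff_fixed: "(h a b - h b a) / 2 \<in> fixed_elements \<sigma>"
  by (simp add: fixed_elements_def)

section \<open>Type (c): pseudo-quadratic forms\<close>

lemma root_data_wf_pseudo_quadratic: "root_data_wf (pseudo_quadratic_form_type \<sigma> r h)"
    (is "root_data_wf ?D")
proof -
  have "group (grp13 ?D)"
  proof (rule groupI)
    fix p assume "p \<in> carrier (grp13 ?D)"
    then obtain a c where "p = (a, c)" "c \<in> fixed_elements \<sigma>"
      by (auto simp: pseudo_quadratic_form_type_def)
    then show "\<exists>p'\<in>carrier (grp13 ?D). p' \<otimes>\<^bsub>grp13 ?D\<^esub> p = \<one>\<^bsub>grp13 ?D\<^esub>"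
      using fixed_elements_closed
      by (intro bexI[of _ "(- a, - c)"]) (simp_all add: pseudo_quadratic_form_type_def)
  qed (auto simp: pseudo_quadratic_form_type_def fixed_elements_closed
      half_diff_fixed[unfolded diff_divide_distrib]
      add_divide_distrib diff_divide_distrib)
  moreover have "group (grp24 ?D)"
    by (auto simp: pseudo_quadratic_form_type_def intro!: group_additive_group)
  ultimately show ?thesis
    by (auto simp: root_data_wf_def pseudo_quadratic_form_type_def additive_group_def fixed_elements_closed)
qed

lemma root_data_iso_pseudo_quadratic:
  "root_data_iso (pseudo_quadratic_form_type \<sigma> r h)
     (construction_M K J diag_e0 diag_e1 (offdiag 1) M act \<beta>)"
    (is "root_data_iso ?D ?D'")
proof -
  let ?f = "\<lambda>(x, a). (vec2 x 0, corner a)"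
  show ?thesis
  proof (rule root_data_isoI[where f = ?f and g = offdiag])
    show "root_data_wf ?D"
      by (rule root_data_wf_pseudo_quadratic)
    show "?f \<in> iso (grp13 ?D) (grp13 ?D')"
      unfolding construction_M_def pseudo_quadratic_form_type_def root_data.simps peirce_zero_J
        special_module_0_M
      by (auto simp: iso_iff hom_def inj_on_def corner_def half_K half_mult image_iff)
    show "offdiag \<in> iso (grp24 ?D) (grp24 ?D')"
      unfolding construction_M_def pseudo_quadratic_form_type_def root_data.simps peirce_half_J
      by (auto simp: iso_iff hom_def inj_on_def additive_group_def offdiag_def)
  next
    fix p p'
    show "offdiag (c13 ?D p p') = c13 ?D' (?f p) (?f p')"
      by (cases p; cases p') (simp add: construction_M_def pseudo_quadratic_form_type_def offdiag_def)
  next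
    fix v w
    show "?f (c24 ?D v w) = c24 ?D' (offdiag v) (offdiag w)"
      using c24_J by (simp add: construction_M_def pseudo_quadratic_form_type_def vec2_zero del: J_simps(1))
  next
    fix p l assume "p \<in> carrier (grp13 ?D)"
    then obtain x a where p: "p = (x, a)" and a: "a \<in> fixed_elements \<sigma>"
      by (auto simp: pseudo_quadratic_form_type_def)
    have "act (offdiag 1) (vec2 x 0) = vec2 0 x" "act (offdiag l) (vec2 0 x) = vec2 (r x l) 0"
      by (simp_all add: offdiag_def)
    \<comment> \<open>The lower left entry of the form is h(x, x l), and the upper right one, -h(x
      l, x), is its conjugate by skew-hermitian symmetry.\<close>
    moreover have "(1 / 2) \<odot>\<^bsub>J\<^esub> \<beta> (vec2 0 x) (vec2 (r x l) 0) + offdiag (a * l) =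
        offdiag (h x (r x l) / 2 + a * l)"
      by (simp add: offdiag_def half_mult h_scale_left)
    ultimately show "offdiag (c14_2 ?D p l) = c14_2 ?D' (?f p) (offdiag l) \<and>
        ?f (c14_3 ?D p l) = c14_3 ?D' (?f p) (offdiag l)"
      using a c14_2_J
      by (simp add: p construction_M_def pseudo_quadratic_form_type_def U_base_J U_offdiag_J half_K
          del: J_simps(1,5) \<beta>_vec2 h_simps(3))
  qed (simp_all add: construction_M_def pseudo_quadratic_form_type_def additive_group_def corner_def
      offdiag_def mat2_zero vec2_zero)
qed

end

section \<open>The four types assembled\<close>

theorem mainTheorem4:
  fixes sA :: "'k::field \<Rightarrow> 'v::ab_group_add \<Rightarrow> 'v" and qA :: "'v \<Rightarrow> 'k" and eA :: 'v
    and \<sigma> :: "'l::division_ring \<Rightarrow> 'l"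
    and r :: "'y::ab_group_add \<Rightarrow> 'l \<Rightarrow> 'y" and hY :: "'y \<Rightarrow> 'y \<Rightarrow> 'l"
    and \<iota> :: "'f::field \<Rightarrow> 'e::field"
    and s :: "'f \<Rightarrow> 'w::ab_group_add \<Rightarrow> 'w" and q :: "'w \<Rightarrow> 'f" and e :: 'w
    and t :: "'f \<Rightarrow> 'z::ab_group_add \<Rightarrow> 'z" and m :: "'z \<Rightarrow> 'w \<Rightarrow> 'z" and h :: "'z \<Rightarrow> 'z \<Rightarrow> 'w"
  shows
    "(CHAR('k) \<noteq> 2 \<and> quadratic_space sA qA \<and> anisotropic qA \<and> nondegenerate_form qA \<and> qA eA = 1
      \<longrightarrow> (\<exists>u act \<beta>.
        let K = ring_of_type_algebra; J = spin_factor sA qA; M = zero_module;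
            D = quadratic_form_type sA qA; D' = construction_M K J spin_e0 spin_e1 u M act \<beta>
        in M_input K J spin_e0 spin_e1 u M act \<beta> \<and> root_data_iso D D' \<and>
           (\<forall>(U :: 'g monoid) U1 U2 U3 U4.
              root_group_sequence U U1 U2 U3 U4 D \<longleftrightarrow> root_group_sequence U U1 U2 U3 U4 D')))
     \<and>
     (CHAR('l) \<noteq> 2 \<and> involution \<sigma>
      \<longrightarrow> (\<exists>(K :: 'l ring) u act \<beta>.
        let J = hermitian_matrices \<sigma>; M = zero_module;
            D = involutory_type \<sigma>; D' = construction_M K J diag_e0 diag_e1 u M act \<beta>
        in M_input K J diag_e0 diag_e1 u M act \<beta> \<and> root_data_iso D D' \<and>
           (\<forall>(U :: 'g monoid) U1 U2 U3 U4.
              root_group_sequence U U1 U2 U3 U4 D \<longleftrightarrow> root_group_sequence U U1 U2 U3 U4 D')))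
     \<and>
     (CHAR('l) \<noteq> 2 \<and> involution \<sigma> \<and> right_vector_space r \<and> skew_hermitian_form \<sigma> r hY \<and>
      pseudo_anisotropic \<sigma> hY
      \<longrightarrow> (\<exists>(K :: 'l ring) u \<beta>.
        let J = hermitian_matrices \<sigma>; M = row_module r; act = row_action r;
            D = pseudo_quadratic_form_type \<sigma> r hY;
            D' = construction_M K J diag_e0 diag_e1 u M act \<beta>
        in M_input K J diag_e0 diag_e1 u M act \<beta> \<and> root_data_iso D D' \<and>
           (\<forall>(U :: 'g monoid) U1 U2 U3 U4.
              root_group_sequence U U1 U2 U3 U4 D \<longleftrightarrow> root_group_sequence U U1 U2 U3 U4 D')))
     \<and>
     (CHAR('f) \<noteq> 2 \<and> quadrangular_algebra s q e t m h \<and>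
      (type_E6 \<iota> s q \<and> vector_space.dim t UNIV = 8 \<or>
       type_E7 \<iota> s q \<and> vector_space.dim t UNIV = 16 \<or>
       type_E8 \<iota> s q \<and> vector_space.dim t UNIV = 32)
      \<longrightarrow> (\<exists>u (M :: ('f, 'z \<times> 'z) module) act \<beta>.
        let K = ring_of_type_algebra; J = spin_factor s q;
            D = exceptional_type s q e m h; D' = construction_M K J spin_e0 spin_e1 u M act \<beta>
        in M_input K J spin_e0 spin_e1 u M act \<beta> \<and> root_data_iso D D' \<and>
           (\<forall>(U :: 'g monoid) U1 U2 U3 U4.
              root_group_sequence U U1 U2 U3 U4 D \<longleftrightarrow> root_group_sequence U U1 U2 U3 U4 D')))"
proof (intro conjI impI)
  assume "CHAR('k) \<noteq> 2 \<and> quadratic_space sA qA \<and> anisotropic qA \<and> nondegenerate_form qA \<and> qA eA = 1"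
  then interpret A: spin sA qA eA
    by (intro spin.intro spin_axioms.intro)
      (auto simp: quadratic_space_def anisotropic_def dest: two_neq_zero_of_CHAR)
  note iso = A.root_data_iso_quadratic
  show "\<exists>u act \<beta>.
        let K = ring_of_type_algebra; J = spin_factor sA qA; M = zero_module;
            D = quadratic_form_type sA qA; D' = construction_M K J spin_e0 spin_e1 u M act \<beta>
        in M_input K J spin_e0 spin_e1 u M act \<beta> \<and> root_data_iso D D' \<and>
           (\<forall>(U :: 'g monoid) U1 U2 U3 U4.
              root_group_sequence U U1 U2 U3 U4 D \<longleftrightarrow> root_group_sequence U U1 U2 U3 U4 D')"
    \<comment> \<open>The existential witnesses remain schematic until the \<open>M_input\<close>
      fact fixes them; the same holds in the other three cases.\<close>
    unfolding Let_def
    by (intro exI conjI allI, rule A.M_input_spin_zero, rule iso, rule root_group_sequence_iso[OF iso])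
next
  assume "CHAR('l) \<noteq> 2 \<and> involution \<sigma>"
  then interpret B: skew_involution \<sigma>
    by (intro skew_involution.intro) (auto dest: two_neq_zero_of_CHAR)
  note iso = B.root_data_iso_involutory
  show "\<exists>(K :: 'l ring) u act \<beta>.
        let J = hermitian_matrices \<sigma>; M = zero_module;
            D = involutory_type \<sigma>; D' = construction_M K J diag_e0 diag_e1 u M act \<beta>
        in M_input K J diag_e0 diag_e1 u M act \<beta> \<and> root_data_iso D D' \<and>
           (\<forall>(U :: 'g monoid) U1 U2 U3 U4.
              root_group_sequence U U1 U2 U3 U4 D \<longleftrightarrow> root_group_sequence U U1 U2 U3 U4 D')"
    unfolding Let_def
    by (intro exI conjI allI, rule B.M_input_involutory, rule iso, rule root_group_sequence_iso[OF iso])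
next
  assume "CHAR('l) \<noteq> 2 \<and> involution \<sigma> \<and> right_vector_space r \<and> skew_hermitian_form \<sigma> r hY \<and>
      pseudo_anisotropic \<sigma> hY"
  then interpret C: pseudo_quadratic \<sigma> r hY
    by (intro pseudo_quadratic.intro skew_involution.intro pseudo_quadratic_axioms.intro)
      (auto dest: two_neq_zero_of_CHAR)
  note iso = C.root_data_iso_pseudo_quadratic
  show "\<exists>(K :: 'l ring) u \<beta>.
        let J = hermitian_matrices \<sigma>; M = row_module r; act = row_action r;
            D = pseudo_quadratic_form_type \<sigma> r hY;
            D' = construction_M K J diag_e0 diag_e1 u M act \<beta>
        in M_input K J diag_e0 diag_e1 u M act \<beta> \<and> root_data_iso D D' \<and>
           (\<forall>(U :: 'g monoid) U1 U2 U3 U4.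
              root_group_sequence U U1 U2 U3 U4 D \<longleftrightarrow> root_group_sequence U U1 U2 U3 U4 D')"
    unfolding Let_def
    by (intro exI conjI allI, rule C.M_input_pseudo_quadratic, rule iso, rule root_group_sequence_iso[OF iso])
next
  assume "CHAR('f) \<noteq> 2 \<and> quadrangular_algebra s q e t m h \<and>
      (type_E6 \<iota> s q \<and> vector_space.dim t UNIV = 8 \<or>
       type_E7 \<iota> s q \<and> vector_space.dim t UNIV = 16 \<or>
       type_E8 \<iota> s q \<and> vector_space.dim t UNIV = 32)"
  then have two: "(2::'f) \<noteq> 0" and qa: "quadrangular_algebra s q e t m h"
    by (auto dest: two_neq_zero_of_CHAR)
  then have "spin s q e"
    by (intro spin.intro spin_axioms.intro)
      (auto simp: quadrangular_algebra_def quadratic_space_def anisotropic_def)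
  with qa interpret D: quadrangular s q e t m h
    by (intro quadrangular.intro quadrangular_axioms.intro)
  note iso = D.root_data_iso_exceptional
  show "\<exists>u (M :: ('f, 'z \<times> 'z) module) act \<beta>.
        let K = ring_of_type_algebra; J = spin_factor s q;
            D = exceptional_type s q e m h; D' = construction_M K J spin_e0 spin_e1 u M act \<beta>
        in M_input K J spin_e0 spin_e1 u M act \<beta> \<and> root_data_iso D D' \<and>
           (\<forall>(U :: 'g monoid) U1 U2 U3 U4.
              root_group_sequence U U1 U2 U3 U4 D \<longleftrightarrow> root_group_sequence U U1 U2 U3 U4 D')"
    unfolding Let_def
    by (intro exI conjI allI, rule D.M_input_quadrangular, rule iso, rule root_group_sequence_iso[OF iso])
qed

end
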